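(* Let $\alpha,\beta,\gamma$ be nonzero real constants and let $s\in\mathbb{R}$. Consider the periodic Schrödinger–Benjamin–Ono system $$i u_t+u_{xx}=\alpha vu,\qquad v_t+\gamma\mathcal{H}v_{xx}=\beta(|u|^2)_x,\qquad (u,v)|_{t=0}=(u_0,v_0),\qquad x\in\mathbb{T},$$ and for $0<|t|\ll 1$ let $\Phi^t:(u_0,v_0)\in H^s(\mathbb{T})\times H^{s-\frac12}(\mathbb{T})\mapsto (u(t),v(t))\in H^s(\mathbb{T})\times H^{s-\frac12}(\mathbb{T})$ be its solution map. (a) Suppose $|\gamma|\neq 0,1$. If the solution map $\Phi^t$ is $C^2$ on $H^s(\mathbb{T})\times H^{s-\frac12}(\mathbb{T})$, then $s\ge\frac12$. (b) If $|\gamma|=1$, then for every $s\in\mathbb{R}$ the solution map $\Phi^t$ is not $C^2$ on $H^s(\mathbb{T})\times H^{s-\frac12}(\mathbb{T})$.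
   Context: $\mathbb{T}=[0,2\pi)$ with periodic boundary conditions; $u$ is complex-valued and $v$ is real-valued. $\mathcal{H}$ is the Hilbert transform, with Fourier multiplier $-i\,\mathrm{sgn}(n)$. $H^s(\mathbb{T})$ is the usual $L^2$-based Sobolev space. Standing assumption: the system is assumed to be locally well-posed in $H^s(\mathbb{T})\times H^{s-\frac12}(\mathbb{T})$ over a small time interval, and $t\ne0$ is a fixed small time for which the solution map $\Phi^t$ is well-defined. Solutions are understood in the sense of the Duhamel integral equations $$u(t)=U(t)u_0-i\alpha\int_0^tU(t-t')(uv)(t')\,dt',\qquad v(t)=V(t)v_0+\beta\int_0^tV(t-t')\partial_x(|u|^2)(t')\,dt',$$ where $U(t)=e^{it\partial_x^2}$ and $V(t)=e^{-\gamma t\mathcal{H}\partial_x^2}$. In particular, the solution with zero initial data is identically zero. *)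

theory Defs
  imports "HOL-Analysis.Analysis"
begin

section \<open>Square-summable sequences as real Hilbert spaces\<close>

text \<open>
  Sobolev spaces \<open>H^s\<close> are sets depending on the real number \<open>s\<close>, whereas the Frechet derivative of
  HOL-Analysis is tied to types. The calculus is therefore done on two fixed types, the spaces of
  all and of all Hermitian-symmetric square-summable sequences; \<open>H^s\<close> is isometric to the former,
  and the real-valued elements of \<open>H^s\<close> to the latter, by multiplying Fourier coefficients
  with powers of \<open>(1 + n^2)^(1/2)\<close>.
\<close>

definition sq_summable :: "(int \<Rightarrow> complex) \<Rightarrow> bool" where
  "sq_summable a \<longleftrightarrow> (\<lambda>n. (cmod (a n))\<^sup>2) summable_on UNIV"

lemma sq_summable_prod:
  assumes "sq_summable a" "sq_summable b"
  shows "(\<lambda>n. Re (a n * cnj (b n))) summable_on UNIV"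
proof -
  have "(\<lambda>n. (cmod (a n))\<^sup>2 + (cmod (b n))\<^sup>2) summable_on UNIV"
    using assms unfolding sq_summable_def by (intro summable_on_add)
  moreover have "norm (Re (a n * cnj (b n))) \<le> (cmod (a n))\<^sup>2 + (cmod (b n))\<^sup>2" for n
  proof -
    have "norm (Re (a n * cnj (b n))) \<le> cmod (a n) * cmod (b n)"
      using abs_Re_le_cmod[of "a n * cnj (b n)"] by (simp add: norm_mult)
    also have "\<dots> \<le> (cmod (a n))\<^sup>2 + (cmod (b n))\<^sup>2"
      using sum_squares_bound[of "cmod (a n)" "cmod (b n)"]
        mult_nonneg_nonneg[OF norm_ge_zero[of "a n"] norm_ge_zero[of "b n"]]
      unfolding mult.assoc by linarith
    finally show ?thesis .
  qed
  ultimately have "(\<lambda>n. norm (Re (a n * cnj (b n)))) summable_on UNIV"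
    by (rule Infinite_Sum.abs_summable_on_comparison_test')
  then show ?thesis
    by (rule summable_on_iff_abs_summable_on_real[THEN iffD2])
qed

lemma sq_summable_add:
  assumes "sq_summable a" "sq_summable b"
  shows "sq_summable (\<lambda>n. a n + b n)"
proof -
  have eq: "(cmod (a n + b n))\<^sup>2 = (cmod (a n))\<^sup>2 + (cmod (b n))\<^sup>2 + 2 * Re (a n * cnj (b n))" for n
    unfolding cmod_power2 by (simp add: power2_eq_square algebra_simps)
  show ?thesis
    unfolding sq_summable_def eq
    using assms sq_summable_prod[OF assms]
    by (intro summable_on_add summable_on_cmult_right) (auto simp: sq_summable_def)
qed

lemma sq_summable_scaleR: "sq_summable a \<Longrightarrow> sq_summable (\<lambda>n. c *\<^sub>R a n)"
  unfolding sq_summable_def by (simp add: power_mult_distrib summable_on_cmult_right)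

typedef ell2 = "{a. sq_summable a}" morphisms ell2_nth Abs_ell2
  by (rule exI[of _ "\<lambda>_. 0"]) (simp add: sq_summable_def)

setup_lifting type_definition_ell2

lemma sq_summable_ell2_nth: "sq_summable (ell2_nth a)"
  using ell2_nth[of a] by simp

instantiation ell2 :: real_inner
begin

lift_definition zero_ell2 :: ell2 is "\<lambda>_. 0" by (simp add: sq_summable_def)
lift_definition plus_ell2 :: "ell2 \<Rightarrow> ell2 \<Rightarrow> ell2" is "\<lambda>a b n. a n + b n"
  by (rule sq_summable_add)
lift_definition scaleR_ell2 :: "real \<Rightarrow> ell2 \<Rightarrow> ell2" is "\<lambda>c a n. c *\<^sub>R a n"
  by (rule sq_summable_scaleR)
definition uminus_ell2 :: "ell2 \<Rightarrow> ell2" where "uminus_ell2 a = (-1) *\<^sub>R a"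
definition minus_ell2 :: "ell2 \<Rightarrow> ell2 \<Rightarrow> ell2" where "minus_ell2 a b = a + - b"
lift_definition inner_ell2 :: "ell2 \<Rightarrow> ell2 \<Rightarrow> real" is
  "\<lambda>a b. \<Sum>\<^sub>\<infinity>n. Re (a n * cnj (b n))" .
definition norm_ell2 :: "ell2 \<Rightarrow> real" where "norm_ell2 a = sqrt (a \<bullet> a)"
definition dist_ell2 :: "ell2 \<Rightarrow> ell2 \<Rightarrow> real" where "dist_ell2 a b = norm (a - b)"
definition sgn_ell2 :: "ell2 \<Rightarrow> ell2" where "sgn_ell2 a = inverse (norm a) *\<^sub>R a"
definition uniformity_ell2 :: "(ell2 \<times> ell2) filter" where
  "uniformity_ell2 = (INF e\<in>{0<..}. principal {(x, y). dist x y < e})"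
definition open_ell2 :: "ell2 set \<Rightarrow> bool" where
  "open_ell2 S \<longleftrightarrow> (\<forall>x\<in>S. \<forall>\<^sub>F (x', y) in uniformity. x' = x \<longrightarrow> y \<in> S)"

instance
proof
  fix a b c :: ell2 and r q :: real
  show "a + b + c = a + (b + c)" by transfer (simp add: add.assoc)
  show "a + b = b + a" by transfer (simp add: add.commute)
  show "0 + a = a" by transfer simp
  show "- a + a = 0" unfolding uminus_ell2_def by transfer simp
  show "a - b = a + - b" by (rule minus_ell2_def)
  show "r *\<^sub>R (a + b) = r *\<^sub>R a + r *\<^sub>R b" by transfer (simp add: scaleR_add_right)
  show "(r + q) *\<^sub>R a = r *\<^sub>R a + q *\<^sub>R a" by transfer (simp add: scaleR_add_left)
  show "r *\<^sub>R q *\<^sub>R a = (r * q) *\<^sub>R a" by transfer simp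
  show "1 *\<^sub>R a = a" by transfer simp
  show "dist a b = norm (a - b)" by (rule dist_ell2_def)
  show "sgn a = inverse (norm a) *\<^sub>R a" by (rule sgn_ell2_def)
  show "uniformity = (INF e\<in>{0<..}. principal {(x :: ell2, y). dist x y < e})"
    by (rule uniformity_ell2_def)
  show "open S \<longleftrightarrow> (\<forall>x\<in>S. \<forall>\<^sub>F (x', y) in uniformity. x' = x \<longrightarrow> y \<in> S)" for S :: "ell2 set"
    by (rule open_ell2_def)
  show "a \<bullet> b = b \<bullet> a" by transfer (simp add: mult.commute)
  show "(a + b) \<bullet> c = a \<bullet> c + b \<bullet> c"
  proof transfer
    fix a b c :: "int \<Rightarrow> complex"
    assume "sq_summable a" "sq_summable b" "sq_summable c"
    then have "(\<Sum>\<^sub>\<infinity>n. Re (a n * cnj (c n)) + Re (b n * cnj (c n)))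
        = (\<Sum>\<^sub>\<infinity>n. Re (a n * cnj (c n))) + (\<Sum>\<^sub>\<infinity>n. Re (b n * cnj (c n)))"
      by (intro infsum_add sq_summable_prod)
    then show "(\<Sum>\<^sub>\<infinity>n. Re ((a n + b n) * cnj (c n)))
        = (\<Sum>\<^sub>\<infinity>n. Re (a n * cnj (c n))) + (\<Sum>\<^sub>\<infinity>n. Re (b n * cnj (c n)))"
      by (simp add: algebra_simps)
  qed
  show "r *\<^sub>R a \<bullet> b = r * (a \<bullet> b)"
  proof transfer
    fix r and a b :: "int \<Rightarrow> complex"
    have "(\<Sum>\<^sub>\<infinity>n. r * Re (a n * cnj (b n))) = r * (\<Sum>\<^sub>\<infinity>n. Re (a n * cnj (b n)))"
      by (rule infsum_cmult_right')
    then show "(\<Sum>\<^sub>\<infinity>n. Re (r *\<^sub>R a n * cnj (b n))) = r * (\<Sum>\<^sub>\<infinity>n. Re (a n * cnj (b n)))"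
      by (simp add: algebra_simps)
  qed
  have sq: "Re (z * cnj z) = (cmod z)\<^sup>2" for z
    unfolding cmod_power2 by (simp add: power2_eq_square)
  show "0 \<le> a \<bullet> a"
    by transfer (simp only: sq, rule infsum_nonneg, simp)
  show "a \<bullet> a = 0 \<longleftrightarrow> a = 0"
  proof transfer
    fix a :: "int \<Rightarrow> complex"
    assume s: "sq_summable a"
    have "a = (\<lambda>_. 0)" if "(\<Sum>\<^sub>\<infinity>n. (cmod (a n))\<^sup>2) = 0"
    proof
      fix n
      have "(cmod (a n))\<^sup>2 = 0"
        using that s nonneg_infsum_le_0D[of "\<lambda>n. (cmod (a n))\<^sup>2" UNIV n]
        unfolding sq_summable_def by auto
      then show "a n = 0" by simp
    qed
    then show "(\<Sum>\<^sub>\<infinity>n. Re (a n * cnj (a n))) = 0 \<longleftrightarrow> a = (\<lambda>_. 0)"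
      unfolding sq by auto
  qed
  show "norm a = sqrt (a \<bullet> a)" by (rule norm_ell2_def)
qed

end

lemma ell2_norm_sq: "(norm a)\<^sup>2 = (\<Sum>\<^sub>\<infinity>n. (cmod (ell2_nth a n))\<^sup>2)"
proof -
  have "Re (z * cnj z) = (cmod z)\<^sup>2" for z
    unfolding cmod_power2 by (simp add: power2_eq_square)
  then show ?thesis
    by (simp only: power2_norm_eq_inner inner_ell2.rep_eq)
qed

text \<open>Sequences of Fourier coefficients of real-valued functions or distributions.\<close>

definition hermitian :: "(int \<Rightarrow> complex) \<Rightarrow> bool" where
  "hermitian a \<longleftrightarrow> (\<forall>n. a (- n) = cnj (a n))"

typedef herm_ell2 = "{a :: ell2. hermitian (ell2_nth a)}" morphisms herm_emb Abs_herm_ell2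
  by (rule exI[of _ 0]) (simp add: hermitian_def zero_ell2.rep_eq)

setup_lifting type_definition_herm_ell2

lemma hermitian_herm_emb: "hermitian (ell2_nth (herm_emb a))"
  using herm_emb[of a] by simp

instantiation herm_ell2 :: real_inner
begin

lift_definition zero_herm_ell2 :: herm_ell2 is 0
  by (simp add: hermitian_def zero_ell2.rep_eq)
lift_definition plus_herm_ell2 :: "herm_ell2 \<Rightarrow> herm_ell2 \<Rightarrow> herm_ell2" is "(+)"
  by (simp add: hermitian_def plus_ell2.rep_eq)
lift_definition scaleR_herm_ell2 :: "real \<Rightarrow> herm_ell2 \<Rightarrow> herm_ell2" is "(*\<^sub>R)"
  by (simp add: hermitian_def scaleR_ell2.rep_eq)
definition uminus_herm_ell2 :: "herm_ell2 \<Rightarrow> herm_ell2" where "uminus_herm_ell2 a = (-1) *\<^sub>R a"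
definition minus_herm_ell2 :: "herm_ell2 \<Rightarrow> herm_ell2 \<Rightarrow> herm_ell2" where
  "minus_herm_ell2 a b = a + - b"
lift_definition inner_herm_ell2 :: "herm_ell2 \<Rightarrow> herm_ell2 \<Rightarrow> real" is "(\<bullet>)" .
lift_definition norm_herm_ell2 :: "herm_ell2 \<Rightarrow> real" is norm .
definition dist_herm_ell2 :: "herm_ell2 \<Rightarrow> herm_ell2 \<Rightarrow> real" where
  "dist_herm_ell2 a b = norm (a - b)"
definition sgn_herm_ell2 :: "herm_ell2 \<Rightarrow> herm_ell2" where "sgn_herm_ell2 a = inverse (norm a) *\<^sub>R a"
definition uniformity_herm_ell2 :: "(herm_ell2 \<times> herm_ell2) filter" where
  "uniformity_herm_ell2 = (INF e\<in>{0<..}. principal {(x, y). dist x y < e})"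
definition open_herm_ell2 :: "herm_ell2 set \<Rightarrow> bool" where
  "open_herm_ell2 S \<longleftrightarrow> (\<forall>x\<in>S. \<forall>\<^sub>F (x', y) in uniformity. x' = x \<longrightarrow> y \<in> S)"

instance
proof
  fix a b c :: herm_ell2 and r q :: real
  show "a + b + c = a + (b + c)" by transfer (simp add: add.assoc)
  show "a + b = b + a" by transfer (simp add: add.commute)
  show "0 + a = a" by transfer simp
  show "- a + a = 0" unfolding uminus_herm_ell2_def by transfer simp
  show "a - b = a + - b" by (rule minus_herm_ell2_def)
  show "r *\<^sub>R (a + b) = r *\<^sub>R a + r *\<^sub>R b" by transfer (simp add: scaleR_add_right)
  show "(r + q) *\<^sub>R a = r *\<^sub>R a + q *\<^sub>R a" by transfer (simp add: scaleR_add_left)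
  show "r *\<^sub>R q *\<^sub>R a = (r * q) *\<^sub>R a" by transfer simp
  show "1 *\<^sub>R a = a" by transfer simp
  show "dist a b = norm (a - b)" by (rule dist_herm_ell2_def)
  show "sgn a = inverse (norm a) *\<^sub>R a" by (rule sgn_herm_ell2_def)
  show "uniformity = (INF e\<in>{0<..}. principal {(x :: herm_ell2, y). dist x y < e})"
    by (rule uniformity_herm_ell2_def)
  show "open S \<longleftrightarrow> (\<forall>x\<in>S. \<forall>\<^sub>F (x', y) in uniformity. x' = x \<longrightarrow> y \<in> S)" for S :: "herm_ell2 set"
    by (rule open_herm_ell2_def)
  show "a \<bullet> b = b \<bullet> a" by transfer (rule inner_commute)
  show "(a + b) \<bullet> c = a \<bullet> c + b \<bullet> c" by transfer (rule inner_add_left)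
  show "r *\<^sub>R a \<bullet> b = r * (a \<bullet> b)" by transfer simp
  show "0 \<le> a \<bullet> a" by transfer simp
  show "a \<bullet> a = 0 \<longleftrightarrow> a = 0" by transfer simp
  show "norm a = sqrt (a \<bullet> a)" by transfer (rule norm_eq_sqrt_inner)
qed

end


section \<open>Sobolev spaces on the circle\<close>

text \<open>
  A periodic distribution is represented by its sequence of Fourier coefficients, with the
  normalisation \<open>f = (\<Sum>n. f n * exp (i n x))\<close>. A state is a pair \<open>(u, v)\<close>.
\<close>

type_synonym coeffs = "int \<Rightarrow> complex"
type_synonym state = "coeffs \<times> coeffs"

definition jb :: "int \<Rightarrow> real" where
  "jb n = sqrt (1 + (real_of_int n)\<^sup>2)"

definition sobolev :: "real \<Rightarrow> coeffs set" where
  "sobolev s = {f. (\<lambda>n. jb n powr (2 * s) * (cmod (f n))\<^sup>2) summable_on UNIV}"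

definition sobolev_norm :: "real \<Rightarrow> coeffs \<Rightarrow> real" where
  "sobolev_norm s f = sqrt (\<Sum>\<^sub>\<infinity>n. jb n powr (2 * s) * (cmod (f n))\<^sup>2)"

text \<open>The phase space \<open>H^s \<times> H^(s - 1/2)\<close> with real-valued second component.\<close>

definition sbo_space :: "real \<Rightarrow> state set" where
  "sbo_space s = {(f, g). f \<in> sobolev s \<and> g \<in> sobolev (s - 1/2) \<and> hermitian g}"

text \<open>
  The isometry from pairs of square-summable sequences onto the phase space
  (lemmas \<open>bij_betw_from_ell2\<close> and \<open>norm_from_ell2\<close>), and its inverse. The topology and the
  differentiable structure of the phase space are expressed through it.
\<close>

definition from_ell2 :: "real \<Rightarrow> ell2 \<times> herm_ell2 \<Rightarrow> state" where
  "from_ell2 s z =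
    (\<lambda>n. of_real (jb n powr (- s)) * ell2_nth (fst z) n,
     \<lambda>n. of_real (jb n powr (- (s - 1/2))) * ell2_nth (herm_emb (snd z)) n)"

definition to_ell2 :: "real \<Rightarrow> state \<Rightarrow> ell2 \<times> herm_ell2" where
  "to_ell2 s = inv (from_ell2 s)"

lemma jb_pos: "jb n > 0"
  unfolding jb_def by (simp add: add_pos_nonneg)

lemma jb_minus: "jb (- n) = jb n"
  by (simp add: jb_def)

lemma jb_weight_sq: "(cmod (of_real (jb n powr r) * z))\<^sup>2 = jb n powr (2 * r) * (cmod z)\<^sup>2"
proof -
  have "jb n powr (2 * r) = (jb n powr r)\<^sup>2"
    unfolding power2_eq_square mult_2 by (rule powr_add)
  then show ?thesis
    by (simp add: norm_mult power_mult_distrib)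
qed

lemma jb_cancel: "of_real (jb n powr r) * (of_real (jb n powr (- r)) * z) = (z :: complex)"
  "of_real (jb n powr (- r)) * (of_real (jb n powr r) * z) = (z :: complex)"
proof -
  have "jb n powr r * jb n powr (- r) = 1"
    using jb_pos[of n] by (simp add: powr_add[symmetric])
  then have 1: "complex_of_real (jb n powr r) * of_real (jb n powr (- r)) = 1"
    unfolding of_real_mult[symmetric] by (simp only: of_real_1)
  then have 2: "complex_of_real (jb n powr (- r)) * of_real (jb n powr r) = 1"
    by (simp only: mult.commute)
  show "of_real (jb n powr r) * (of_real (jb n powr (- r)) * z) = (z :: complex)"
    unfolding mult.assoc[symmetric] 1 by (rule mult_1_left)
  show "of_real (jb n powr (- r)) * (of_real (jb n powr r) * z) = (z :: complex)"
    unfolding mult.assoc[symmetric] 2 by (rule mult_1_left)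
qed

lemma sobolev_iff: "f \<in> sobolev r \<longleftrightarrow> sq_summable (\<lambda>n. of_real (jb n powr r) * f n)"
  by (simp add: sobolev_def sq_summable_def jb_weight_sq)

lemma bij_betw_from_ell2: "bij_betw (from_ell2 s) UNIV (sbo_space s)"
proof (rule bij_betwI')
  fix z w :: "ell2 \<times> herm_ell2"
  show "from_ell2 s z = from_ell2 s w \<longleftrightarrow> z = w"
  proof
    assume eq: "from_ell2 s z = from_ell2 s w"
    have nz: "complex_of_real (jb n powr r) \<noteq> 0" for n r
      using jb_pos[of n] by simp
    have "ell2_nth (fst z) n = ell2_nth (fst w) n" for n
    proof -
      have "fst (from_ell2 s z) n = fst (from_ell2 s w) n" by (simp only: eq)
      then show ?thesis
        unfolding from_ell2_def fst_conv mult_left_cancel[OF nz] .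
    qed
    then have 1: "fst z = fst w"
      by (intro ell2_nth_inject[THEN iffD1] ext)
    have "ell2_nth (herm_emb (snd z)) n = ell2_nth (herm_emb (snd w)) n" for n
    proof -
      have "snd (from_ell2 s z) n = snd (from_ell2 s w) n" by (simp only: eq)
      then show ?thesis
        unfolding from_ell2_def snd_conv mult_left_cancel[OF nz] .
    qed
    then have "snd z = snd w"
      by (intro herm_emb_inject[THEN iffD1] ell2_nth_inject[THEN iffD1] ext)
    with 1 show "z = w"
      by (rule prod_eqI)
  qed simp
next
  fix z :: "ell2 \<times> herm_ell2"
  have "hermitian (\<lambda>n. of_real (jb n powr r) * ell2_nth (herm_emb (snd z)) n)" for r
    using hermitian_herm_emb[of "snd z"] unfolding hermitian_def jb_minus
    by (metis complex_cnj_complex_of_real complex_cnj_mult)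
  then show "from_ell2 s z \<in> sbo_space s"
    unfolding sbo_space_def from_ell2_def mem_Collect_eq case_prod_conv sobolev_iff jb_cancel
    using sq_summable_ell2_nth by blast
next
  fix p assume "p \<in> sbo_space s"
  then obtain f g where p: "p = (f, g)" and f: "f \<in> sobolev s"
    and g: "g \<in> sobolev (s - 1/2)" and h: "hermitian g"
    by (auto simp: sbo_space_def)
  define a where "a = Abs_ell2 (\<lambda>n. of_real (jb n powr s) * f n)"
  define b where "b = Abs_ell2 (\<lambda>n. of_real (jb n powr (s - 1/2)) * g n)"
  have a: "ell2_nth a = (\<lambda>n. of_real (jb n powr s) * f n)"
    unfolding a_def using f by (intro Abs_ell2_inverse) (simp add: sobolev_iff)
  have b: "ell2_nth b = (\<lambda>n. of_real (jb n powr (s - 1/2)) * g n)"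
    unfolding b_def using g by (intro Abs_ell2_inverse) (simp add: sobolev_iff)
  have "hermitian (ell2_nth b)"
    using h unfolding b hermitian_def jb_minus
    by (metis complex_cnj_complex_of_real complex_cnj_mult)
  then have "herm_emb (Abs_herm_ell2 b) = b"
    by (intro Abs_herm_ell2_inverse) simp
  then have "from_ell2 s (a, Abs_herm_ell2 b) = p"
    unfolding from_ell2_def p by (simp only: fst_conv snd_conv a b jb_cancel)
  then show "\<exists>z\<in>UNIV. p = from_ell2 s z" by auto
qed

lemma norm_from_ell2:
  "norm z = sqrt ((sobolev_norm s (fst (from_ell2 s z)))\<^sup>2
                + (sobolev_norm (s - 1/2) (snd (from_ell2 s z)))\<^sup>2)"
proof -
  have *: "(sobolev_norm r (\<lambda>n. of_real (jb n powr (- r)) * ell2_nth a n))\<^sup>2 = (norm a)\<^sup>2" for r a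
  proof -
    have "jb n powr (2 * r) * (cmod (of_real (jb n powr (- r)) * ell2_nth a n))\<^sup>2
        = (cmod (ell2_nth a n))\<^sup>2" for n
      by (subst jb_weight_sq[symmetric]) (simp only: jb_cancel)
    then show ?thesis
      unfolding sobolev_norm_def ell2_norm_sq
      by (simp only: real_sqrt_pow2 infsum_nonneg zero_le_power2)
  qed
  have "norm (snd z) = norm (herm_emb (snd z))"
    by (rule norm_herm_ell2.rep_eq)
  then show ?thesis
    unfolding norm_prod_def from_ell2_def fst_conv snd_conv * by (simp only:)
qed

text \<open>Twice continuously Frechet differentiable on an open set.\<close>

definition C2_on :: "'a::real_normed_vector set \<Rightarrow> ('a \<Rightarrow> 'b::real_normed_vector) \<Rightarrow> bool" where
  "C2_on A F \<longleftrightarrow>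
    (\<exists>(F' :: 'a \<Rightarrow> 'a \<Rightarrow>\<^sub>L 'b) (F'' :: 'a \<Rightarrow> 'a \<Rightarrow>\<^sub>L ('a \<Rightarrow>\<^sub>L 'b)).
      (\<forall>x\<in>A. (F has_derivative blinfun_apply (F' x)) (at x)) \<and>
      (\<forall>x\<in>A. (F' has_derivative blinfun_apply (F'' x)) (at x)) \<and>
      continuous_on A F'')"

definition sbo_C2_on :: "real \<Rightarrow> state set \<Rightarrow> (state \<Rightarrow> state) \<Rightarrow> bool" where
  "sbo_C2_on s D F \<longleftrightarrow> C2_on (to_ell2 s ` D) (to_ell2 s \<circ> F \<circ> from_ell2 s)"

text \<open>The class \<open>C([-T, T]; H^s \<times> H^(s - 1/2))\<close>.\<close>

definition cont_curve :: "real \<Rightarrow> real \<Rightarrow> (real \<Rightarrow> state) \<Rightarrow> bool" where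
  "cont_curve s T w \<longleftrightarrow>
    w ` {-T..T} \<subseteq> sbo_space s \<and> continuous_on {-T..T} (\<lambda>t. to_ell2 s (w t))"


section \<open>The Schroedinger--Benjamin--Ono system\<close>

definition deriv_mult :: "int \<Rightarrow> complex" where
  "deriv_mult n = \<i> * of_int n"

definition hilbert_mult :: "int \<Rightarrow> complex" where
  "hilbert_mult n = - \<i> * of_int (sgn n)"

text \<open>Multipliers of \<open>U(t) = exp (i t D^2)\<close> and \<open>V(t) = exp (- \<gamma> t H D^2)\<close>, \<open>D = d/dx\<close>.\<close>

definition U_mult :: "real \<Rightarrow> int \<Rightarrow> complex" where
  "U_mult t n = exp (\<i> * of_real t * (deriv_mult n)\<^sup>2)"

definition V_mult :: "real \<Rightarrow> real \<Rightarrow> int \<Rightarrow> complex" where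
  "V_mult \<gamma> t n = exp (- of_real \<gamma> * of_real t * hilbert_mult n * (deriv_mult n)\<^sup>2)"

definition pmult :: "coeffs \<Rightarrow> coeffs \<Rightarrow> coeffs" where
  "pmult f g n = (\<Sum>\<^sub>\<infinity>k. f (n - k) * g k)"

definition pconj :: "coeffs \<Rightarrow> coeffs" where
  "pconj f n = cnj (f (- n))"

definition trunc :: "nat \<Rightarrow> coeffs \<Rightarrow> coeffs" where
  "trunc N f n = (if \<bar>n\<bar> \<le> int N then f n else 0)"

text \<open>
  \<open>w = (u, v)\<close> solves the Duhamel equations on \<open>[-T, T]\<close> with data \<open>d\<close>. For small \<open>s\<close> the
  products \<open>u v\<close> and \<open>|u|^2\<close> of two elements of the phase space need not exist at a fixed time, so
  the Duhamel integrals are taken, frequency by frequency, as limits of the integrals of the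
  products of the Fourier partial sums. The integrals are oriented (\<open>t\<close> may be negative).
\<close>

definition sbo_solution ::
  "real \<Rightarrow> real \<Rightarrow> real \<Rightarrow> real \<Rightarrow> state \<Rightarrow> (real \<Rightarrow> state) \<Rightarrow> bool" where
  "sbo_solution \<alpha> \<beta> \<gamma> T d w \<longleftrightarrow>
    (\<forall>t\<in>{-T..T}. \<forall>n.
      (\<lambda>N. U_mult t n * fst d n
         - \<i> * of_real \<alpha> * (LBINT r=0..t. U_mult (t - r) n *
              pmult (trunc N (fst (w r))) (trunc N (snd (w r))) n))
        \<longlonglongrightarrow> fst (w t) n \<and>
      (\<lambda>N. V_mult \<gamma> t n * snd d n
         + of_real \<beta> * (LBINT r=0..t. V_mult \<gamma> (t - r) n * (deriv_mult n *
              pmult (trunc N (fst (w r))) (pconj (trunc N (fst (w r)))) n)))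
        \<longlonglongrightarrow> snd (w t) n)"

text \<open>
  Local well-posedness on \<open>[-T, T]\<close> for data in an open neighbourhood \<open>D\<close> of the origin of
  \<open>H^s \<times> H^(s - 1/2)\<close> (the data whose solution lives on \<open>[-T, T]\<close>, possibly the whole space), with
  solution map \<open>\<Phi>\<close>: existence, uniqueness in some class of curves \<open>\<X>\<close>, and continuity of the map
  from data to \<open>C([-T, T]; H^s \<times> H^(s - 1/2))\<close>. As usual \<open>\<X>\<close> is an unspecified auxiliary class,
  but it contains the curves that are continuous into every Sobolev space, so that for
  smooth data the solution map gives the smooth solution if there is one.
\<close>

definition sbo_wellposed ::
  "real \<Rightarrow> real \<Rightarrow> real \<Rightarrow> real \<Rightarrow> real \<Rightarrow> state set \<Rightarrow> (real \<Rightarrow> state \<Rightarrow> state) \<Rightarrow> bool" where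
  "sbo_wellposed \<alpha> \<beta> \<gamma> s T D \<Phi> \<longleftrightarrow>
    D \<subseteq> sbo_space s \<and> (\<lambda>_. 0, \<lambda>_. 0) \<in> D \<and> open (to_ell2 s ` D) \<and>
    (\<exists>\<X>. {w. \<forall>\<sigma>. cont_curve \<sigma> T w} \<subseteq> \<X> \<and> \<X> \<subseteq> {w. cont_curve s T w} \<and>
      (\<forall>d\<in>D. (\<lambda>t. \<Phi> t d) \<in> \<X> \<and> sbo_solution \<alpha> \<beta> \<gamma> T d (\<lambda>t. \<Phi> t d) \<and>
        (\<forall>w\<in>\<X>. sbo_solution \<alpha> \<beta> \<gamma> T d w \<longrightarrow> (\<forall>t\<in>{-T..T}. w t = \<Phi> t d)))) \<and>
    (\<forall>d\<in>D. \<forall>\<epsilon>>0. \<exists>\<delta>>0. \<forall>e\<in>D. dist (to_ell2 s e) (to_ell2 s d) < \<delta> \<longrightarrow>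
      (\<forall>t\<in>{-T..T}. dist (to_ell2 s (\<Phi> t e)) (to_ell2 s (\<Phi> t d)) < \<epsilon>))"

end

theory Submission
  imports Defs
begin

text \<open>
  A \<open>C\<^sup>2\<close> solution map has at the origin a second derivative that is a bounded bilinear map. On
  trigonometric polynomials this derivative must be the second Picard iterate, whose \<open>u\<close>-component
  at frequency \<open>n\<^sub>1 + n\<^sub>2\<close>, for one mode \<open>n\<^sub>1\<close> of \<open>u\<close> and one mode \<open>n\<^sub>2\<close> of \<open>v\<close>, is a multiple of
  \<open>\<integral>\<^sub>0\<^sup>t exp (i r \<theta>) dr\<close> with \<open>\<theta> = (n\<^sub>1 + n\<^sub>2)\<^sup>2 - n\<^sub>1\<^sup>2 - \<gamma> n\<^sub>2 |n\<^sub>2|\<close>. If \<open>|\<gamma>| = 1\<close>, then \<open>n\<^sub>1 = 0\<close> is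
  exactly resonant (with \<open>n\<^sub>2\<close> of the sign of \<open>\<gamma>\<close>), and half a derivative is lost. Otherwise Dirichlet
  approximation of \<open>(\<gamma> - 1) / 2\<close> gives \<open>n\<^sub>1 / n\<^sub>2\<close> with \<open>|\<theta>| \<le> 2\<close> and all three frequencies
  comparable, and boundedness forces \<open>s \<ge> 1/2\<close>.

  As only the time-\<open>t\<close> map is assumed to be smooth, and the Duhamel terms may make no sense for
  rough solutions, the expansion of the flow is proved for analytic solutions. Since the nonlinearity
  loses one derivative, they are constructed as in the Cauchy-Kovalevskaya theorem: in norms whose
  strip of analyticity shrinks in time the Duhamel integral regains the derivative.
  These solutions exist on all of \<open>[-T, T]\<close> for small data, and uniqueness identifies them with \<open>\<Phi>\<close>.
\<close>

section \<open>Convolution in weighted spaces of analytic functions\<close>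

text \<open>\<open>\<mu>\<close> is the width of the strip of analyticity.\<close>

definition wgt :: "real \<Rightarrow> int \<Rightarrow> real" where
  "wgt \<mu> n = exp (- \<mu> * \<bar>of_int n\<bar>) / (1 + (of_int n)\<^sup>2)"

text \<open>The 4 is the factor 2 of \<open>wgt_mult_le\<close> times the two copies of
  \<open>wgt 0\<close> on its right-hand side, which have the same sum over
  \<open>k\<close>.\<close>

definition conv_const :: real where
  "conv_const = 4 * (\<Sum>\<^sub>\<infinity>n. wgt 0 n)"

lemma wgt_pos: "wgt \<mu> n > 0"
  unfolding wgt_def by (intro divide_pos_pos) (auto simp: add_pos_nonneg)

lemma wgt_nonneg [simp]: "wgt \<mu> n \<ge> 0"
  using wgt_pos[of \<mu> n] by linarith

lemma wgt_antimono: "\<mu> \<le> \<nu> \<Longrightarrow> wgt \<nu> n \<le> wgt \<mu> n"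
  unfolding wgt_def by (intro divide_right_mono) (auto intro: mult_right_mono)

lemma wgt_le_1: "\<mu> \<ge> 0 \<Longrightarrow> wgt \<mu> n \<le> 1"
proof -
  assume "\<mu> \<ge> 0"
  then have "wgt \<mu> n \<le> wgt 0 n" by (rule wgt_antimono)
  also have "\<dots> \<le> 1" unfolding wgt_def by (simp add: divide_simps add_pos_nonneg)
  finally show ?thesis .
qed

lemma wgt_minus [simp]: "wgt \<mu> (- n) = wgt \<mu> n"
  by (simp add: wgt_def)

lemma summable_on_int_even:
  fixes f :: "int \<Rightarrow> real"
  assumes "summable (\<lambda>k::nat. f (int k))" "\<And>n. f n \<ge> 0" "\<And>n. f (- n) = f n"
  shows "f summable_on UNIV"
proof -
  have 1: "(\<lambda>k::nat. f (int k)) summable_on UNIV"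
    using assms by (subst summable_on_UNIV_nonneg_real_iff) auto
  have "f summable_on range int"
    using 1 by (subst summable_on_reindex) (auto simp: o_def)
  moreover have "f summable_on range (\<lambda>k. - int k)"
    using 1 assms(3) by (subst summable_on_reindex) (auto simp: o_def inj_on_def)
  ultimately have "f summable_on (range int \<union> range (\<lambda>k. - int k))"
    by (rule summable_on_union)
  moreover have "range int \<union> range (\<lambda>k. - int k) = UNIV"
    by (auto simp: image_iff) (metis int_cases2)
  ultimately show ?thesis by simp
qed

lemma wgt_summable: "\<mu> \<ge> 0 \<Longrightarrow> wgt \<mu> summable_on UNIV"
proof -
  assume "\<mu> \<ge> 0"
  have "wgt 0 summable_on UNIV"
  proof (rule summable_on_int_even)
    have "summable (\<lambda>n. inverse (real (Suc n) ^ 2))"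
      using inverse_power_summable[of 2, where 'a = real] by (subst summable_Suc_iff) simp
    then have "summable (\<lambda>n. 2 * inverse (real (Suc n) ^ 2))" by (rule summable_mult)
    then show "summable (\<lambda>k::nat. wgt 0 (int k))"
    proof (rule summable_comparison_test')
      fix n :: nat assume "n \<ge> 0"
      have "(real n + 1)\<^sup>2 \<le> 2 * (1 + (real n)\<^sup>2)"
        using sum_squares_bound[of "real n" 1] by (simp add: power2_eq_square algebra_simps)
      moreover have "(real n + 1)\<^sup>2 > 0" by simp
      moreover have "1 + (real n)\<^sup>2 > 0" by (simp add: add_pos_nonneg)
      ultimately show "norm (wgt 0 (int n)) \<le> 2 * inverse (real (Suc n) ^ 2)"
        by (simp add: wgt_def field_simps)
    qed
  qed (auto simp: wgt_def)
  then show ?thesis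
    by (rule summable_on_comparison_test) (use \<open>\<mu> \<ge> 0\<close> in \<open>auto intro: wgt_antimono\<close>)
qed

lemma wgt_shift_summable: "(\<lambda>k. wgt 0 (n - k)) summable_on UNIV"
  and wgt_shift_infsum: "(\<Sum>\<^sub>\<infinity>k. wgt 0 (n - k)) = (\<Sum>\<^sub>\<infinity>k. wgt 0 k)"
proof -
  have bij: "bij_betw (\<lambda>k::int. n - k) UNIV UNIV"
    by (rule bij_betwI[where g = "\<lambda>k. n - k"]) auto
  show "(\<lambda>k. wgt 0 (n - k)) summable_on UNIV"
    using summable_on_reindex_bij_betw[OF bij, of "wgt 0"] wgt_summable[of 0] by simp
  show "(\<Sum>\<^sub>\<infinity>k. wgt 0 (n - k)) = (\<Sum>\<^sub>\<infinity>k. wgt 0 k)"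
    using infsum_reindex_bij_betw[OF bij, of "wgt 0"] by simp
qed

text \<open>The exponential factor is submultiplicative by the triangle inequality. For the rational
  factor, 1 + (a + b)^2 is at most twice (1 + a^2) + (1 + b^2); dividing by the product of all three
  quantities leaves one factor that is summable in \<open>k\<close>. Hence the sequences dominated
  by \<open>wgt \<mu>\<close> are closed under convolution, with a constant that does not depend on
  \<mu>.\<close>

lemma wgt_mult_le:
  assumes "\<mu> \<ge> 0"
  shows "wgt \<mu> (n - k) * wgt \<mu> k \<le> 2 * wgt \<mu> n * (wgt 0 (n - k) + wgt 0 k)"
proof -
  define a b where "a = real_of_int (n - k)" and "b = real_of_int k"
  define p q r where "p = 1 / (1 + a\<^sup>2)" and "q = 1 / (1 + b\<^sup>2)" and "r = 1 / (1 + (a + b)\<^sup>2)"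
  have n: "real_of_int n = a + b" by (simp add: a_def b_def)
  have "\<mu> * \<bar>a + b\<bar> \<le> \<mu> * (\<bar>a\<bar> + \<bar>b\<bar>)"
    using assms by (intro mult_left_mono) auto
  then have e: "exp (- \<mu> * \<bar>a\<bar>) * exp (- \<mu> * \<bar>b\<bar>) \<le> exp (- \<mu> * \<bar>a + b\<bar>)"
    unfolding exp_add[symmetric] exp_le_cancel_iff by (simp add: algebra_simps)
  have wgt_eq: "wgt \<nu> j = exp (- \<nu> * \<bar>real_of_int j\<bar>) * (1 / (1 + (real_of_int j)\<^sup>2))" for \<nu> j
    by (simp add: wgt_def)
  have pos: "1 + a\<^sup>2 > 0" "1 + b\<^sup>2 > 0" "1 + (a + b)\<^sup>2 > 0" by (simp_all add: add_pos_nonneg)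
  have "1 + (a + b)\<^sup>2 \<le> 2 * ((1 + b\<^sup>2) + (1 + a\<^sup>2))"
    using sum_squares_bound[of a b] by (simp add: power2_eq_square algebra_simps)
  then have "p * q \<le> 2 * r * (p + q)"
    using pos unfolding p_def q_def r_def by (simp add: divide_simps mult.commute) 
  then have "exp (- \<mu> * \<bar>a\<bar>) * exp (- \<mu> * \<bar>b\<bar>) * (p * q) \<le> exp (- \<mu> * \<bar>a + b\<bar>) * (2 * r * (p + q))"
    by (rule mult_mono[OF e]) (use pos in \<open>auto simp: p_def q_def\<close>)
  then show ?thesis
    unfolding wgt_eq n a_def[symmetric] b_def[symmetric] p_def[symmetric] q_def[symmetric] r_def[symmetric]
    by (simp add: algebra_simps)
qed

lemma conv_const_pos: "conv_const > 0"
proof -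
  have "wgt 0 0 \<le> (\<Sum>\<^sub>\<infinity>n. wgt 0 n)"
    using finite_sum_le_infsum[OF wgt_summable[of 0], of "{0}"] by simp
  then show ?thesis using wgt_pos[of 0 0] by (simp add: conv_const_def)
qed

context
  fixes \<mu> A B :: real and f g :: coeffs
  assumes mu: "\<mu> \<ge> 0" and f: "\<And>k. cmod (f k) \<le> A * wgt \<mu> k" and g: "\<And>k. cmod (g k) \<le> B * wgt \<mu> k"
begin

lemma pmult_term_le:
  "cmod (f (n - k) * g k) \<le> A * B * (2 * wgt \<mu> n * (wgt 0 (n - k) + wgt 0 k))"
proof -
  have A: "A \<ge> 0"
    using order.trans[OF norm_ge_zero f, of 0] wgt_pos[of \<mu> 0] by (simp add: zero_le_mult_iff)
  have B: "B \<ge> 0"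
    using order.trans[OF norm_ge_zero g, of 0] wgt_pos[of \<mu> 0] by (simp add: zero_le_mult_iff)
  have "cmod (f (n - k) * g k) \<le> (A * wgt \<mu> (n - k)) * (B * wgt \<mu> k)"
    unfolding norm_mult using A by (intro mult_mono f g) auto
  also have "\<dots> = A * B * (wgt \<mu> (n - k) * wgt \<mu> k)" by simp
  also have "\<dots> \<le> A * B * (2 * wgt \<mu> n * (wgt 0 (n - k) + wgt 0 k))"
    using A B mu by (intro mult_left_mono wgt_mult_le) auto
  finally show ?thesis .
qed

lemma pmult_majorant_summable:
  "(\<lambda>k. A * B * (2 * wgt \<mu> n * (wgt 0 (n - k) + wgt 0 k))) summable_on UNIV"
  by (intro summable_on_cmult_right summable_on_add wgt_shift_summable wgt_summable) simp

lemma pmult_summable: "(\<lambda>k. f (n - k) * g k) summable_on UNIV"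
  by (rule abs_summable_summable[OF Infinite_Sum.abs_summable_on_comparison_test'[OF pmult_majorant_summable pmult_term_le]])

lemma pmult_le: "cmod (pmult f g n) \<le> A * B * conv_const * wgt \<mu> n"
proof -
  have "cmod (pmult f g n) \<le> (\<Sum>\<^sub>\<infinity>k. A * B * (2 * wgt \<mu> n * (wgt 0 (n - k) + wgt 0 k)))"
    unfolding pmult_def
    by (rule norm_infsum_le[OF has_sum_infsum[OF pmult_summable] has_sum_infsum[OF pmult_majorant_summable] pmult_term_le])
  also have "\<dots> = A * B * conv_const * wgt \<mu> n"
    by (simp add: infsum_cmult_right' infsum_add wgt_shift_summable wgt_summable wgt_shift_infsum conv_const_def)
  finally show ?thesis .
qed

text \<open>This is the limit over truncations that \<open>sbo_solution\<close> asks for. Truncating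
  both factors restricts the sum to the finite sets \<open>S N\<close>, which exhaust the integers,
  and an unconditionally convergent sum converges along any such exhaustion.\<close>

lemma pmult_trunc_tendsto:
  "(\<lambda>N. pmult (trunc N f) (trunc N g) n) \<longlonglongrightarrow> pmult f g n"
proof -
  define S where "S N = {k. \<bar>n - k\<bar> \<le> int N \<and> \<bar>k\<bar> \<le> int N}" for N
  have fin: "finite (S N)" for N
    by (rule finite_subset[of _ "{- int N..int N}"]) (auto simp: S_def)
  have "pmult (trunc N f) (trunc N g) n = (\<Sum>k\<in>S N. f (n - k) * g k)" for N
  proof -
    have "pmult (trunc N f) (trunc N g) n = (\<Sum>\<^sub>\<infinity>k\<in>S N. f (n - k) * g k)"
      unfolding pmult_def by (rule infsum_cong_neutral) (auto simp: S_def trunc_def)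
    then show ?thesis using fin by simp
  qed
  moreover have "filterlim S (finite_subsets_at_top UNIV) sequentially"
    unfolding filterlim_finite_subsets_at_top
  proof (intro allI impI)
    fix X :: "int set" assume X: "finite X \<and> X \<subseteq> UNIV"
    \<comment> \<open>The sum of nonnegative terms over \<open>X\<close> bounds each of them, so one
      threshold serves every \<open>k\<close> in \<open>X\<close>.\<close>
    define M where "M = nat (\<Sum>k\<in>X. \<bar>n - k\<bar> + \<bar>k\<bar>)"
    have "X \<subseteq> S N" if "N \<ge> M" for N
    proof
      fix k assume "k \<in> X"
      then have "\<bar>n - k\<bar> + \<bar>k\<bar> \<le> (\<Sum>k\<in>X. \<bar>n - k\<bar> + \<bar>k\<bar>)"
        using X by (intro member_le_sum) auto
      then show "k \<in> S N" using that by (auto simp: S_def M_def)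
    qed
    then show "\<forall>\<^sub>F N in sequentially. finite (S N) \<and> X \<subseteq> S N \<and> S N \<subseteq> UNIV"
      using fin by (auto simp: eventually_sequentially)
  qed
  ultimately show ?thesis
    using filterlim_compose[OF has_sum_infsum[OF pmult_summable, unfolded has_sum_def], of S]
    unfolding pmult_def by simp
qed

end

lemma infsum_diff:
  fixes f g :: "'a \<Rightarrow> 'b::{topological_ab_group_add, t2_space}"
  assumes "f summable_on A" "g summable_on A"
  shows "(\<Sum>\<^sub>\<infinity>x\<in>A. f x - g x) = infsum f A - infsum g A"
proof (rule infsumI)
  have "((\<lambda>x. - g x) has_sum (- infsum g A)) A"
    using has_sum_infsum[OF assms(2)] by (simp add: has_sum_uminus)
  from has_sum_add[OF has_sum_infsum[OF assms(1)] this]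
  show "((\<lambda>x. f x - g x) has_sum (infsum f A - infsum g A)) A" by simp
qed

lemma pmult_diff_left:
  assumes "\<mu> \<ge> 0" "\<And>k. cmod (f k) \<le> A * wgt \<mu> k" "\<And>k. cmod (f' k) \<le> A' * wgt \<mu> k" "\<And>k. cmod (g k) \<le> B * wgt \<mu> k"
  shows "pmult (\<lambda>k. f k - f' k) g n = pmult f g n - pmult f' g n"
  unfolding pmult_def left_diff_distrib
  by (rule infsum_diff) (rule pmult_summable[OF assms(1)], use assms in auto)+

lemma pmult_diff_right:
  assumes "\<mu> \<ge> 0" "\<And>k. cmod (f k) \<le> A * wgt \<mu> k" "\<And>k. cmod (g k) \<le> B * wgt \<mu> k" "\<And>k. cmod (g' k) \<le> B' * wgt \<mu> k"
  shows "pmult f (\<lambda>k. g k - g' k) n = pmult f g n - pmult f g' n"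
  unfolding pmult_def right_diff_distrib
  by (rule infsum_diff) (rule pmult_summable[OF assms(1)], use assms in auto)+

text \<open>The majorant makes the finite partial sums converge uniformly, and a uniform limit of
  continuous functions is continuous.\<close>

lemma continuous_on_infsum:
  fixes f :: "'a \<Rightarrow> 'b::topological_space \<Rightarrow> 'c::banach"
  assumes "\<And>x y. y \<in> Y \<Longrightarrow> norm (f x y) \<le> M x" "M summable_on UNIV"
    and "\<And>x. continuous_on Y (f x)"
  shows "continuous_on Y (\<lambda>y. \<Sum>\<^sub>\<infinity>x. f x y)"
  by (rule uniform_limit_theorem[OF _ Weierstrass_m_test_general[OF assms(1,2)]])
     (auto intro!: always_eventually continuous_on_sum assms(3))


section \<open>Duhamel integrals in shrinking strips\<close>

text \<open>A ball of radius \<open>A\<close> in a space of analytic curves. The strip narrows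
  linearly from width T + 1 at time 0 to width 1 at the end times. The width left at the end gives a
  majorant independent of time (\<open>traj_le_uniform\<close>) and membership in every Sobolev
  space.\<close>

definition traj :: "real \<Rightarrow> real \<Rightarrow> (real \<Rightarrow> coeffs) \<Rightarrow> bool" where
  "traj T A f \<longleftrightarrow> (\<forall>n. continuous_on {-T..T} (\<lambda>t. f t n)) \<and>
    (\<forall>t\<in>{-T..T}. \<forall>n. cmod (f t n) \<le> A * wgt (T + 1 - \<bar>t\<bar>) n)"

lemma trajI:
  assumes "\<And>n. continuous_on {-T..T} (\<lambda>t. f t n)"
    and "\<And>t n. t \<in> {-T..T} \<Longrightarrow> cmod (f t n) \<le> A * wgt (T + 1 - \<bar>t\<bar>) n"
  shows "traj T A f"
  using assms by (simp add: traj_def)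

lemma traj_cont: "traj T A f \<Longrightarrow> continuous_on {-T..T} (\<lambda>t. f t n)"
  by (simp add: traj_def)

lemma traj_le: "traj T A f \<Longrightarrow> t \<in> {-T..T} \<Longrightarrow> cmod (f t n) \<le> A * wgt (T + 1 - \<bar>t\<bar>) n"
  by (simp add: traj_def)

lemma traj_rate: "t \<in> {-T..T} \<Longrightarrow> T + 1 - \<bar>t\<bar> \<ge> 0" for t T :: real
  by auto

lemma traj_cong:
  assumes "traj T A f" "\<And>t n. t \<in> {-T..T} \<Longrightarrow> g t n = f t n"
  shows "traj T A g"
proof (rule trajI)
  show "continuous_on {-T..T} (\<lambda>t. g t n)" for n
    using traj_cont[OF assms(1), of n] by (subst continuous_on_cong[OF refl assms(2)])
qed (use assms in \<open>auto dest: traj_le\<close>)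

lemma traj_mono:
  assumes "traj T A f" "A \<le> B"
  shows "traj T B f"
proof (rule trajI)
  fix t n assume "t \<in> {-T..T}"
  then have "cmod (f t n) \<le> A * wgt (T + 1 - \<bar>t\<bar>) n" by (rule traj_le[OF assms(1)])
  also have "\<dots> \<le> B * wgt (T + 1 - \<bar>t\<bar>) n" using assms(2) by (intro mult_right_mono) auto
  finally show "cmod (f t n) \<le> B * wgt (T + 1 - \<bar>t\<bar>) n" .
qed (use assms traj_cont in auto)

lemma traj_nonneg:
  assumes "traj T A f" "T \<ge> 0"
  shows "A \<ge> 0"
proof -
  have "0 \<le> A * wgt (T + 1 - \<bar>0\<bar>) 0"
    using order.trans[OF norm_ge_zero traj_le[OF assms(1), of 0 0]] assms(2) by simp
  then show ?thesis using wgt_pos[of "T + 1 - \<bar>0\<bar>" 0] by (simp add: zero_le_mult_iff)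
qed

lemma traj_le_uniform:
  assumes "traj T A f" "t \<in> {-T..T}"
  shows "cmod (f t n) \<le> A * wgt 1 n"
proof -
  have "cmod (f t n) \<le> A * wgt (T + 1 - \<bar>t\<bar>) n" using assms by (rule traj_le)
  also have "\<dots> \<le> A * wgt 1 n"
    using traj_nonneg[OF assms(1)] assms(2) by (intro mult_left_mono wgt_antimono) auto
  finally show ?thesis .
qed

lemma traj_add:
  assumes "traj T A f" "traj T B g"
  shows "traj T (A + B) (\<lambda>t n. f t n + g t n)"
proof (rule trajI)
  fix t n assume "t \<in> {-T..T}"
  then show "cmod (f t n + g t n) \<le> (A + B) * wgt (T + 1 - \<bar>t\<bar>) n"
    using norm_triangle_mono[OF traj_le[OF assms(1)] traj_le[OF assms(2)], of t t n n]
    by (simp add: distrib_right)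
qed (intro continuous_on_add traj_cont[OF assms(1)] traj_cont[OF assms(2)])

lemma traj_cmult:
  assumes "traj T A f"
  shows "traj T (cmod c * A) (\<lambda>t n. c * f t n)"
proof (rule trajI)
  fix t n assume "t \<in> {-T..T}"
  then show "cmod (c * f t n) \<le> cmod c * A * wgt (T + 1 - \<bar>t\<bar>) n"
    using mult_left_mono[OF traj_le[OF assms], of t "cmod c" n] by (simp add: norm_mult)
qed (intro continuous_intros traj_cont[OF assms])

lemma traj_diff:
  assumes "traj T A f" "traj T B g"
  shows "traj T (A + B) (\<lambda>t n. f t n - g t n)"
  using traj_add[OF assms(1) traj_cmult[OF assms(2), of "-1"]] by simp

lemma traj_pconj:
  assumes "traj T A f"
  shows "traj T A (\<lambda>t. pconj (f t))"
  unfolding pconj_def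
proof (rule trajI)
  fix t n assume "t \<in> {-T..T}"
  then show "cmod (cnj (f t (- n))) \<le> A * wgt (T + 1 - \<bar>t\<bar>) n"
    using traj_le[OF assms, of t "-n"] by simp
qed (intro continuous_intros traj_cont[OF assms])

lemma traj_trunc:
  assumes "traj T A f" "T \<ge> 0"
  shows "traj T A (\<lambda>t. trunc N (f t))"
  unfolding trunc_def
proof (rule trajI)
  fix t n assume "t \<in> {-T..T}"
  then show "cmod (if \<bar>n\<bar> \<le> int N then f t n else 0) \<le> A * wgt (T + 1 - \<bar>t\<bar>) n"
    using traj_le[OF assms(1), of t n] traj_nonneg[OF assms] by simp
next
  show "continuous_on {-T..T} (\<lambda>t. if \<bar>n\<bar> \<le> int N then f t n else 0)" for n
    using traj_cont[OF assms(1), of n] by (cases "\<bar>n\<bar> \<le> int N") simp_all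
qed

lemma traj_pmult:
  assumes "traj T A f" "traj T B g" "T \<ge> 0"
  shows "traj T (A * B * conv_const) (\<lambda>t. pmult (f t) (g t))"
proof (rule trajI)
  fix t n assume t: "t \<in> {-T..T}"
  show "cmod (pmult (f t) (g t) n) \<le> A * B * conv_const * wgt (T + 1 - \<bar>t\<bar>) n"
    by (rule pmult_le[OF traj_rate[OF t] traj_le[OF assms(1) t] traj_le[OF assms(2) t]])
next
  fix n
  show "continuous_on {-T..T} (\<lambda>t. pmult (f t) (g t) n)"
    unfolding pmult_def
  proof (rule continuous_on_infsum)
    fix k t assume t: "t \<in> {-T..T}"
    \<comment> \<open>The majorant must not depend on \<open>t\<close>, so the smallest width 1
      replaces T + 1 - |t|.\<close>
    show "norm (f t (n - k) * g t k) \<le> A * B * (2 * wgt 1 n * (wgt 0 (n - k) + wgt 0 k))"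
      by (rule pmult_term_le[OF _ traj_le_uniform[OF assms(1) t] traj_le_uniform[OF assms(2) t]]) simp
  next
    show "(\<lambda>k. A * B * (2 * wgt 1 n * (wgt 0 (n - k) + wgt 0 k))) summable_on UNIV"
      by (intro summable_on_cmult_right summable_on_add wgt_shift_summable wgt_summable) simp
  qed (intro continuous_on_mult traj_cont[OF assms(1)] traj_cont[OF assms(2)])
qed

text \<open>The substitution \<open>r = t x\<close> makes the domain of integration independent of \<open>t\<close> and of its sign.\<close>

lemma interval_integral_scaled:
  fixes f :: "real \<Rightarrow> complex"
  assumes "continuous_on {-T..T} f" "t \<in> {-T..T}"
  shows "(LBINT r=0..t. f r) = integral {0..1} (\<lambda>x. of_real t * f (t * x))"
proof -
  have sub: "(\<lambda>x. t * x) ` {0..1} \<subseteq> {-T..T}"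
  proof clarify
    fix x :: real assume x: "x \<in> {0..1}"
    have "\<bar>t * x\<bar> \<le> \<bar>t\<bar> * 1"
      using x unfolding abs_mult by (intro mult_left_mono) auto
    then show "t * x \<in> {-T..T}" using assms(2) by auto
  qed
  have cont: "continuous_on {0..1} (\<lambda>x. of_real t * f (t * x))"
    by (intro continuous_intros continuous_on_compose2[OF assms(1) _ sub])
  have "(LBINT x=0..1. t *\<^sub>R f (t * x)) = (LBINT r=t * 0..t * 1. f r)"
    using interval_integral_substitution_finite[of 0 1 "\<lambda>x. t * x" "\<lambda>_. t" f]
      continuous_on_subset[OF assms(1) sub]
    by (auto intro!: derivative_eq_intros simp: zero_ereal_def one_ereal_def)
  then have "(LBINT r=0..t. f r) = (LBINT x=0..1. of_real t * f (t * x))"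
    by (simp add: zero_ereal_def one_ereal_def scaleR_conv_of_real)
  also have "\<dots> = integral {0..1} (\<lambda>x. of_real t * f (t * x))"
    using interval_integral_eq_integral[of 0 1, OF _ borel_integrable_atLeastAtMost'[OF cont]]
    by (simp add: zero_ereal_def one_ereal_def)
  finally show ?thesis .
qed

section \<open>The Duhamel operator of a unimodular multiplier\<close>

definition duhamel :: "(real \<Rightarrow> int \<Rightarrow> complex) \<Rightarrow> (real \<Rightarrow> coeffs) \<Rightarrow> real \<Rightarrow> coeffs" where
  "duhamel m f t n = (LBINT r=0..t. m (t - r) n * f r n)"

definition propagator :: "(real \<Rightarrow> int \<Rightarrow> complex) \<Rightarrow> bool" where
  "propagator m \<longleftrightarrow> (\<forall>n. continuous_on UNIV (\<lambda>t. m t n)) \<and> (\<forall>t n. cmod (m t n) = 1)"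

lemma propagator_cont:
  assumes "propagator m" "continuous_on S g"
  shows "continuous_on S (\<lambda>x. m (g x) n)"
  using continuous_on_compose2[of UNIV "\<lambda>t. m t n" S g] assms by (auto simp: propagator_def)

lemma scaled_mem: "t \<in> {-T..T} \<Longrightarrow> x \<in> {0..1} \<Longrightarrow> t * x \<in> {-T..T}" for t T x :: real
proof -
  assume "t \<in> {-T..T}" "x \<in> {0..1}"
  moreover from this have "\<bar>t * x\<bar> \<le> \<bar>t\<bar> * 1"
    unfolding abs_mult by (intro mult_left_mono) auto
  ultimately show ?thesis by auto
qed

lemma duhamel_scaled:
  assumes "propagator m" "continuous_on {-T..T} (\<lambda>r. f r n)" "t \<in> {-T..T}"
  shows "duhamel m f t n = integral {0..1} (\<lambda>x. of_real t * (m (t - t * x) n * f (t * x) n))"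
  unfolding duhamel_def
  by (rule interval_integral_scaled)
     (use assms in \<open>auto intro!: continuous_on_mult propagator_cont continuous_intros\<close>)

text \<open>Joint continuity over a fixed compact range of \<open>x\<close> makes the integral
  continuous in \<open>t\<close>; its slices at fixed \<open>t\<close> give integrability.\<close>

lemma duhamel_integrand_cont:
  assumes "propagator m" "continuous_on {-T..T} (\<lambda>r. f r n)"
  shows "continuous_on ({-T..T} \<times> cbox 0 1) (\<lambda>(t, x). of_real t * (m (t - t * x) n * f (t * x) n))"
proof -
  have "continuous_on ({-T..T} \<times> cbox 0 1) (\<lambda>z. m (fst z - fst z * snd z) n)"
    by (intro propagator_cont assms(1) continuous_intros)
  moreover have "continuous_on ({-T..T} \<times> cbox 0 1) (\<lambda>z. f (fst z * snd z) n)"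
    by (rule continuous_on_compose2[OF assms(2)])
       (use scaled_mem in \<open>fastforce intro!: continuous_intros\<close>)+
  ultimately show ?thesis
    unfolding case_prod_unfold by (intro continuous_intros)
qed

lemma duhamel_integrand_cont_slice:
  assumes "propagator m" "continuous_on {-T..T} (\<lambda>r. f r n)" "t \<in> {-T..T}"
  shows "continuous_on {0..1} (\<lambda>x. of_real t * (m (t - t * x) n * f (t * x) n))"
proof -
  have "continuous_on {0..1} (\<lambda>x. (t, x))" by (intro continuous_intros)
  then have "continuous_on {0..1} (\<lambda>x. (\<lambda>(t, x). of_real t * (m (t - t * x) n * f (t * x) n)) (t, x))"
    by (rule continuous_on_compose2[OF duhamel_integrand_cont[where f = f and n = n, OF assms(1,2)]])
       (use assms(3) in auto)
  then show ?thesis by simp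
qed

lemma duhamel_diff:
  assumes "propagator m" "continuous_on {-T..T} (\<lambda>r. f r n)" "continuous_on {-T..T} (\<lambda>r. g r n)" "t \<in> {-T..T}"
  shows "duhamel m (\<lambda>r k. f r k - g r k) t n = duhamel m f t n - duhamel m g t n"
proof -
  have "duhamel m (\<lambda>r k. f r k - g r k) t n
      = integral {0..1} (\<lambda>x. of_real t * (m (t - t * x) n * (f (t * x) n - g (t * x) n)))"
    by (rule duhamel_scaled) (use assms in \<open>auto intro!: continuous_on_diff\<close>)
  also have "\<dots> = integral {0..1} (\<lambda>x. of_real t * (m (t - t * x) n * f (t * x) n)
      - of_real t * (m (t - t * x) n * g (t * x) n))"
    by (simp add: algebra_simps)
  also have "\<dots> = duhamel m f t n - duhamel m g t n"
    using assms by (simp add: duhamel_scaled[of m T] integral_diff integrable_continuous_interval duhamel_integrand_cont_slice)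
  finally show ?thesis .
qed

lemma duhamel_cmult: "duhamel m (\<lambda>r k. c * f r k) t n = c * duhamel m f t n"
proof -
  have "(\<lambda>r. m (t - r) n * (c * f r n)) = (\<lambda>r. c * (m (t - r) n * f r n))"
    by (simp add: mult.left_commute)
  then show ?thesis by (simp add: duhamel_def interval_lebesgue_integral_def set_lebesgue_integral_def scaleR_conv_of_real mult.left_commute)
qed

text \<open>
  The gain of \<open>1 + |n|\<close> comes from the shrinking width of the analyticity strip:
  integrating the weight in time divides it by \<open>|n|\<close>.
\<close>

lemma duhamel_le:
  assumes "propagator m" "continuous_on {-T..T} (\<lambda>r. f r n)" "t \<in> {-T..T}" "A \<ge> 0"
    and le: "\<And>r. r \<in> {-T..T} \<Longrightarrow> cmod (f r n) \<le> A * (1 + \<bar>of_int n\<bar>) * wgt (T + 1 - \<bar>r\<bar>) n"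
  shows "cmod (duhamel m f t n) \<le> (T + 1) * A * wgt (T + 1 - \<bar>t\<bar>) n"
proof -
  define c where "c = \<bar>t\<bar> * \<bar>of_int n\<bar>"
  define K where "K = A * wgt (T + 1) n"
  have K: "K \<ge> 0" using assms(4) by (simp add: K_def)
  \<comment> \<open>Along r = t x the weight is its value at time 0 times an exponential in
    \<open>x\<close> with rate \<open>c\<close>.\<close>
  have w: "A * wgt (T + 1 - \<bar>t * x\<bar>) n = K * exp (c * x)" if "x \<in> {0..1}" for x
    using that by (simp add: K_def c_def wgt_def abs_mult exp_add[symmetric] algebra_simps)
  have "cmod (duhamel m f t n) = cmod (integral {0..1} (\<lambda>x. of_real t * (m (t - t * x) n * f (t * x) n)))"
    by (simp only: duhamel_scaled[where f = f and n = n, OF assms(1-3)])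
  \<comment> \<open>The factor |t| (1 + |n|) of the integrand splits as |t| + c. The part with
    \<open>c\<close> is the exact derivative of exp (c x), so the frequency disappears on
    integration; the part with |t| is bounded crudely by T exp c.\<close>
  also have "\<dots> \<le> integral {0..1} (\<lambda>x. K * (T * exp c + c * exp (c * x)))"
  proof (rule integral_norm_bound_integral)
    show "(\<lambda>x. of_real t * (m (t - t * x) n * f (t * x) n)) integrable_on {0..1}"
      by (rule integrable_continuous_interval[OF duhamel_integrand_cont_slice[where f = f and n = n, OF assms(1-3)]])
    show "(\<lambda>x. K * (T * exp c + c * exp (c * x))) integrable_on {0..1}"
      by (intro integrable_continuous_interval continuous_intros)
    fix x :: real assume x: "x \<in> {0..1}"
    have "cmod (of_real t * (m (t - t * x) n * f (t * x) n)) = \<bar>t\<bar> * cmod (f (t * x) n)"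
      using assms(1) by (simp add: norm_mult propagator_def)
    also have "\<dots> \<le> \<bar>t\<bar> * (A * (1 + \<bar>of_int n\<bar>) * wgt (T + 1 - \<bar>t * x\<bar>) n)"
      by (intro mult_left_mono le scaled_mem x assms(3)) auto
    also have "\<dots> = (\<bar>t\<bar> + c) * (A * wgt (T + 1 - \<bar>t * x\<bar>) n)"
      by (simp add: c_def algebra_simps)
    also have "\<dots> = K * (\<bar>t\<bar> * exp (c * x) + c * exp (c * x))"
      unfolding w[OF x] by (simp add: algebra_simps)
    also have "\<dots> \<le> K * (T * exp c + c * exp (c * x))"
    proof (intro mult_left_mono add_mono mult_mono order.refl K)
      show "exp (c * x) \<le> exp c"
        using x mult_left_mono[of x 1 c] by (simp add: c_def)
    qed (use assms(3) in \<open>auto simp: c_def\<close>)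
    finally show "norm (of_real t * (m (t - t * x) n * f (t * x) n)) \<le> K * (T * exp c + c * exp (c * x))" .
  qed
  also have "\<dots> = K * (T * exp c + (exp c - 1))"
  proof (rule integral_unique)
    have "((\<lambda>x. c * exp (c * x)) has_integral (exp (c * 1) - exp (c * 0))) {0..1}"
      by (rule fundamental_theorem_of_calculus)
         (auto intro!: derivative_eq_intros simp: has_real_derivative_iff_has_vector_derivative[symmetric])
    then have "((\<lambda>x. c * exp (c * x)) has_integral (exp c - 1)) {0..1}" by simp
    moreover have "((\<lambda>x::real. T * exp c) has_integral (T * exp c)) {0..1}"
      using has_integral_const_real[of "T * exp c" 0 1] by simp
    ultimately have "((\<lambda>x. T * exp c + c * exp (c * x)) has_integral (T * exp c + (exp c - 1))) {0..1}"
      by (rule has_integral_add[rotated])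
    then show "((\<lambda>x. K * (T * exp c + c * exp (c * x))) has_integral K * (T * exp c + (exp c - 1))) {0..1}"
      by (rule has_integral_mult_right)
  qed
  also have "\<dots> \<le> K * ((T + 1) * exp c)"
    using K by (intro mult_left_mono) (auto simp: algebra_simps)
  also have "\<dots> = (T + 1) * A * wgt (T + 1 - \<bar>t\<bar>) n"
    using w[of 1] by simp
  finally show ?thesis .
qed

lemma traj_duhamel:
  assumes "propagator m" "\<And>n. continuous_on {-T..T} (\<lambda>r. f r n)" "A \<ge> 0"
    and "\<And>r n. r \<in> {-T..T} \<Longrightarrow> cmod (f r n) \<le> A * (1 + \<bar>of_int n\<bar>) * wgt (T + 1 - \<bar>r\<bar>) n"
  shows "traj T ((T + 1) * A) (duhamel m f)"
proof (rule trajI)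
  fix n
  have "continuous_on {-T..T} (\<lambda>t. integral (cbox 0 1) (\<lambda>x. of_real t * (m (t - t * x) n * f (t * x) n)))"
    by (rule integral_continuous_on_param[OF duhamel_integrand_cont[where f = f and n = n, OF assms(1,2)]])
  then show "continuous_on {-T..T} (\<lambda>t. duhamel m f t n)"
    using assms by (subst continuous_on_cong[OF refl duhamel_scaled[of m T]]) auto
qed (rule duhamel_le, use assms in auto)

text \<open>Dominated convergence. As the multiplier has modulus 1, a bound on \<open>F N\<close>
  uniform in \<open>N\<close> and \<open>r\<close> provides a constant majorant.\<close>

lemma duhamel_tendsto:
  assumes "propagator m" "\<And>N. continuous_on {-T..T} (\<lambda>r. F N r n)" "continuous_on {-T..T} (\<lambda>r. f r n)"
    and "t \<in> {-T..T}"
    and le: "\<And>N r. r \<in> {-T..T} \<Longrightarrow> cmod (F N r n) \<le> A"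
    and lim: "\<And>r. r \<in> {-T..T} \<Longrightarrow> (\<lambda>N. F N r n) \<longlonglongrightarrow> f r n"
  shows "(\<lambda>N. duhamel m (F N) t n) \<longlonglongrightarrow> duhamel m f t n"
proof -
  have "(\<lambda>N. integral {0..1} (\<lambda>x. of_real t * (m (t - t * x) n * F N (t * x) n)))
     \<longlonglongrightarrow> integral {0..1} (\<lambda>x. of_real t * (m (t - t * x) n * f (t * x) n))"
  proof (rule dominated_convergence(2))
    show "(\<lambda>x. of_real t * (m (t - t * x) n * F N (t * x) n)) integrable_on {0..1}" for N
      using assms by (intro integrable_continuous_interval duhamel_integrand_cont_slice)
    show "(\<lambda>x::real. \<bar>t\<bar> * A) integrable_on {0..1}" by (rule integrable_const_ivl)
    show "norm (of_real t * (m (t - t * x) n * F N (t * x) n)) \<le> \<bar>t\<bar> * A" if "x \<in> {0..1}" for N x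
      using assms(1) le[OF scaled_mem[OF assms(4) that], of N]
      by (simp add: norm_mult propagator_def mult_left_mono)
    show "(\<lambda>N. of_real t * (m (t - t * x) n * F N (t * x) n)) \<longlonglongrightarrow> of_real t * (m (t - t * x) n * f (t * x) n)"
      if "x \<in> {0..1}" for x
      by (intro tendsto_mult tendsto_const lim scaled_mem[OF assms(4) that])
  qed
  then show ?thesis using assms by (simp add: duhamel_scaled[of m T])
qed


section \<open>Picard iteration\<close>

text \<open>Completeness of the space of trajectories, for sequences with geometrically decreasing
  increments. The limit is the telescoping series, whose tail from index \<open>k\<close> is at most
  the geometric tail 2 D / 2^k.\<close>

lemma traj_complete:
  assumes T: "T \<ge> 0" and F: "\<And>k. traj T (A k) (F k)"
    and d: "\<And>k. traj T (D / 2 ^ k) (\<lambda>t n. F (Suc k) t n - F k t n)"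
  obtains f where "\<And>k. traj T (2 * D / 2 ^ k) (\<lambda>t n. f t n - F k t n)"
proof -
  define f where "f t n = F 0 t n + (\<Sum>i. F (Suc i) t n - F i t n)" for t n
  have D: "D \<ge> 0" using traj_nonneg[OF d[of 0] T] by simp
  have geo: "(\<lambda>i. D / 2 ^ (i + k)) sums (2 * D / 2 ^ k)" for k
    using sums_mult[OF geometric_sums[of "1/2 :: real"], of "D / 2 ^ k"]
    by (simp add: power_add power_divide field_simps)
  have le: "cmod (F (Suc k) t n - F k t n) \<le> D / 2 ^ k * wgt (T + 1 - \<bar>t\<bar>) n" if "t \<in> {-T..T}" for k t n
    using traj_le[OF d that] .
  have le1: "cmod (F (Suc k) t n - F k t n) \<le> D / 2 ^ k" if "t \<in> {-T..T}" for k t n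
    by (rule order.trans[OF le[OF that] mult_left_le])
       (use that D in \<open>auto intro!: wgt_le_1 traj_rate\<close>)
  have f_eq: "f t n - F k t n = (\<Sum>i. F (Suc (i + k)) t n - F (i + k) t n)" if "t \<in> {-T..T}" for k t n
  proof -
    have "summable (\<lambda>i. F (Suc i) t n - F i t n)"
      by (rule summable_comparison_test'[OF sums_summable[OF geo[of 0, unfolded add_0_right]] le1[OF that]])
    from suminf_minus_initial_segment[OF this, of k, unfolded sum_lessThan_telescope[of "\<lambda>i. F i t n" k]] show ?thesis
      by (simp add: f_def algebra_simps)
  qed
  have "traj T (2 * D / 2 ^ k) (\<lambda>t n. f t n - F k t n)" for k
  proof (rule trajI)
    fix t n assume t: "t \<in> {-T..T}"
    have s: "(\<lambda>i. D / 2 ^ (i + k) * wgt (T + 1 - \<bar>t\<bar>) n) sums (2 * D / 2 ^ k * wgt (T + 1 - \<bar>t\<bar>) n)"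
      by (rule sums_mult2[OF geo])
    have "norm (\<Sum>i. F (Suc (i + k)) t n - F (i + k) t n) \<le> (\<Sum>i. D / 2 ^ (i + k) * wgt (T + 1 - \<bar>t\<bar>) n)"
      by (rule norm_suminf_le[OF le[OF t] sums_summable[OF s]])
    then show "cmod (f t n - F k t n) \<le> 2 * D / 2 ^ k * wgt (T + 1 - \<bar>t\<bar>) n"
      unfolding f_eq[OF t] sums_unique[OF s] .
  next
    fix n
    have "uniform_limit {-T..T} (\<lambda>m t. \<Sum>i<m. F (Suc (i + k)) t n - F (i + k) t n)
       (\<lambda>t. \<Sum>i. F (Suc (i + k)) t n - F (i + k) t n) sequentially"
      by (rule Weierstrass_m_test[OF le1 sums_summable[OF geo]])
    then have "continuous_on {-T..T} (\<lambda>t. \<Sum>i. F (Suc (i + k)) t n - F (i + k) t n)"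
      by (rule uniform_limit_theorem[rotated])
         (auto intro!: always_eventually continuous_on_sum continuous_on_diff traj_cont[OF F])
    then show "continuous_on {-T..T} (\<lambda>t. f t n - F k t n)"
      by (subst continuous_on_cong[OF refl f_eq])
  qed
  then show ?thesis by (rule that)
qed

text \<open>Serves to pass to the limit in an iteration: the residual of the limit equation does not
  depend on \<open>k\<close>, yet is estimated through the \<open>k\<close>-th iterate for every
  \<open>k\<close>.\<close>

lemma traj_vanish:
  assumes "\<And>k::nat. traj T (C / 2 ^ k) f" "t \<in> {-T..T}"
  shows "f t n = 0"
proof -
  define w where "w = wgt (T + 1 - \<bar>t\<bar>) n"
  have "(\<lambda>k. C / 2 ^ k * w) \<longlonglongrightarrow> C * 0 * w"
    unfolding divide_inverse power_inverse[symmetric]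
    by (intro tendsto_mult tendsto_const LIMSEQ_power_zero) simp
  moreover have "\<forall>k. cmod (f t n) \<le> C / 2 ^ k * w"
    using traj_le[OF assms(1,2)] by (simp add: w_def)
  ultimately have "cmod (f t n) \<le> C * 0 * w"
    by (intro LIMSEQ_le_const) auto
  then show ?thesis by simp
qed

lemma duhamel_cong:
  assumes "propagator m" "continuous_on {-T..T} (\<lambda>r. f r n)"
    and eq: "\<And>r. r \<in> {-T..T} \<Longrightarrow> f r n = g r n" and t: "t \<in> {-T..T}"
  shows "duhamel m f t n = duhamel m g t n"
proof -
  have "continuous_on {-T..T} (\<lambda>r. g r n)"
    using assms(2) by (subst continuous_on_cong[OF refl eq[symmetric]])
  then have "duhamel m g t n = integral {0..1} (\<lambda>x. of_real t * (m (t - t * x) n * g (t * x) n))"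
    by (rule duhamel_scaled[OF assms(1) _ t])
  also have "\<dots> = integral {0..1} (\<lambda>x. of_real t * (m (t - t * x) n * f (t * x) n))"
    by (rule integral_cong) (simp only: eq[OF scaled_mem[OF t]])
  also have "\<dots> = duhamel m f t n"
    by (rule duhamel_scaled[where f = f and n = n, OF assms(1,2) t, symmetric])
  finally show ?thesis by simp
qed

lemma propagator_U: "propagator U_mult"
  unfolding propagator_def U_mult_def deriv_mult_def
  by (auto intro!: continuous_intros simp: norm_exp_eq_Re power_mult_distrib)

lemma propagator_V: "propagator (V_mult \<gamma>)"
  unfolding propagator_def V_mult_def deriv_mult_def hilbert_mult_def
  by (auto intro!: continuous_intros simp: norm_exp_eq_Re power_mult_distrib)

lemma traj_free:
  assumes "propagator m" "\<And>n. cmod (\<phi> n) \<le> A * wgt (T + 1) n" "A \<ge> 0"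
  shows "traj T A (\<lambda>t n. m t n * \<phi> n)"
proof (rule trajI)
  fix t n assume t: "t \<in> {-T..T}"
  have "cmod (m t n * \<phi> n) \<le> A * wgt (T + 1) n"
    using assms(1,2) by (simp add: norm_mult propagator_def)
  also have "\<dots> \<le> A * wgt (T + 1 - \<bar>t\<bar>) n"
    by (intro mult_left_mono wgt_antimono assms(3)) auto
  finally show "cmod (m t n * \<phi> n) \<le> A * wgt (T + 1 - \<bar>t\<bar>) n" .
qed (intro continuous_intros propagator_cont assms(1))

section \<open>The two quadratic Duhamel terms and their estimates\<close>

definition duhamel_u :: "real \<Rightarrow> (real \<Rightarrow> coeffs) \<Rightarrow> (real \<Rightarrow> coeffs) \<Rightarrow> real \<Rightarrow> coeffs" where
  "duhamel_u \<alpha> f g t n = - \<i> * of_real \<alpha> * duhamel U_mult (\<lambda>r. pmult (f r) (g r)) t n"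

text \<open>The two arguments are kept apart, although the equation has the same function in both
  places, so that differences can be expanded one factor at a time.\<close>

definition duhamel_v :: "real \<Rightarrow> real \<Rightarrow> (real \<Rightarrow> coeffs) \<Rightarrow> (real \<Rightarrow> coeffs) \<Rightarrow> real \<Rightarrow> coeffs" where
  "duhamel_v \<beta> \<gamma> f g t n =
    of_real \<beta> * duhamel (V_mult \<gamma>) (\<lambda>r n. deriv_mult n * pmult (f r) (pconj (g r)) n) t n"

locale sbo =
  fixes \<alpha> \<beta> \<gamma> T :: real
  assumes T: "T \<ge> 0"
begin

text \<open>One constant for both equations: \<open>conv_const\<close> comes from the product,
  \<open>T + 1\<close> from the time integral, and the sum of the coupling constants dominates
  either of them.\<close>

definition K :: real where
  "K = (\<bar>\<alpha>\<bar> + \<bar>\<beta>\<bar>) * ((T + 1) * conv_const)"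

lemma K_nonneg: "K \<ge> 0"
  using T conv_const_pos by (simp add: K_def)

text \<open>There is no derivative in this term, so the gain of \<open>traj_duhamel\<close> is given
  away by bounding 1 by 1 + |n|.\<close>

lemma traj_duhamel_u:
  assumes f: "traj T A f" and g: "traj T B g"
  shows "traj T (K * (A * B)) (duhamel_u \<alpha> f g)"
proof -
  note fg = traj_pmult[OF f g T]
  have "traj T ((T + 1) * (A * B * conv_const)) (duhamel U_mult (\<lambda>r. pmult (f r) (g r)))"
  proof (rule traj_duhamel[OF propagator_U traj_cont[OF fg] traj_nonneg[OF fg T]])
    fix r n assume "r \<in> {-T..T}"
    then have "cmod (pmult (f r) (g r) n) \<le> A * B * conv_const * 1 * wgt (T + 1 - \<bar>r\<bar>) n"
      using traj_le[OF fg, of r n] by simp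
    also have "\<dots> \<le> A * B * conv_const * (1 + \<bar>of_int n\<bar>) * wgt (T + 1 - \<bar>r\<bar>) n"
      using traj_nonneg[OF fg T] by (intro mult_right_mono mult_left_mono) auto
    finally show "cmod (pmult (f r) (g r) n) \<le> \<dots>" .
  qed
  from traj_cmult[OF this, of "- \<i> * of_real \<alpha>"]
  show ?thesis
    unfolding duhamel_u_def
  proof (rule traj_mono)
    have "\<bar>\<alpha>\<bar> * ((T + 1) * conv_const * (A * B)) \<le> (\<bar>\<alpha>\<bar> + \<bar>\<beta>\<bar>) * ((T + 1) * conv_const * (A * B))"
      using traj_nonneg[OF f T] traj_nonneg[OF g T] T conv_const_pos by (intro mult_right_mono mult_nonneg_nonneg) auto
    then show "cmod (- \<i> * of_real \<alpha>) * ((T + 1) * (A * B * conv_const)) \<le> K * (A * B)"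
      by (simp add: K_def norm_mult mult_ac)
  qed
qed

text \<open>The derivative costs a factor |n|, which is exactly what the shrinking strip returns in
  \<open>traj_duhamel\<close>. The output therefore lies in the same space as the input, and a
  fixed-point iteration can close.\<close>

lemma traj_duhamel_v:
  assumes f: "traj T A f" and g: "traj T B g"
  shows "traj T (K * (A * B)) (duhamel_v \<beta> \<gamma> f g)"
proof -
  note fg = traj_pmult[OF f traj_pconj[OF g] T]
  have "traj T ((T + 1) * (A * B * conv_const)) (duhamel (V_mult \<gamma>) (\<lambda>r n. deriv_mult n * pmult (f r) (pconj (g r)) n))"
  proof (rule traj_duhamel[OF propagator_V _ traj_nonneg[OF fg T]])
    show "continuous_on {-T..T} (\<lambda>r. deriv_mult n * pmult (f r) (pconj (g r)) n)" for n
      by (intro continuous_intros traj_cont[OF fg])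
    fix r n assume r: "r \<in> {-T..T}"
    have "cmod (deriv_mult n * pmult (f r) (pconj (g r)) n)
        \<le> \<bar>of_int n\<bar> * (A * B * conv_const * wgt (T + 1 - \<bar>r\<bar>) n)"
      unfolding norm_mult by (intro mult_mono traj_le[OF fg r]) (auto simp: deriv_mult_def norm_mult)
    also have "\<dots> \<le> (1 + \<bar>of_int n\<bar>) * (A * B * conv_const * wgt (T + 1 - \<bar>r\<bar>) n)"
      using traj_nonneg[OF fg T] by (intro mult_right_mono) auto
    finally show "cmod (deriv_mult n * pmult (f r) (pconj (g r)) n)
        \<le> A * B * conv_const * (1 + \<bar>of_int n\<bar>) * wgt (T + 1 - \<bar>r\<bar>) n"
      by (simp add: mult_ac)
  qed
  from traj_cmult[OF this, of "of_real \<beta>"]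
  show ?thesis
    unfolding duhamel_v_def
  proof (rule traj_mono)
    have "\<bar>\<beta>\<bar> * ((T + 1) * conv_const * (A * B)) \<le> (\<bar>\<alpha>\<bar> + \<bar>\<beta>\<bar>) * ((T + 1) * conv_const * (A * B))"
      using traj_nonneg[OF f T] traj_nonneg[OF g T] T conv_const_pos by (intro mult_right_mono mult_nonneg_nonneg) auto
    then show "cmod (of_real \<beta>) * ((T + 1) * (A * B * conv_const)) \<le> K * (A * B)"
      by (simp add: K_def mult_ac)
  qed
qed

text \<open>Integrated form of f g - f' g' = (f - f') g + f' (g - g'). The bounds on all four
  functions ensure that the convolutions converge, so that they may be split.\<close>

lemma duhamel_u_diff:
  assumes f: "traj T A f" and f': "traj T A' f'" and g: "traj T B g" and g': "traj T B' g'" and t: "t \<in> {-T..T}"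
  shows "duhamel_u \<alpha> f g t n - duhamel_u \<alpha> f' g' t n
    = duhamel_u \<alpha> (\<lambda>t n. f t n - f' t n) g t n + duhamel_u \<alpha> f' (\<lambda>t n. g t n - g' t n) t n"
proof -
  note c = traj_cont[OF traj_pmult[OF _ _ T]]
  have 1: "duhamel U_mult (\<lambda>r. pmult (f r) (g r)) t n - duhamel U_mult (\<lambda>r. pmult (f' r) (g r)) t n
     = duhamel U_mult (\<lambda>r. pmult (\<lambda>n. f r n - f' r n) (g r)) t n"
    unfolding duhamel_diff[OF propagator_U c[OF f g] c[OF f' g] t, symmetric]
    by (rule duhamel_cong[OF propagator_U _ _ t, symmetric, OF c[OF traj_diff[OF f f'] g]])
       (rule pmult_diff_left[OF traj_rate traj_le[OF f] traj_le[OF f'] traj_le[OF g]])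
  have 2: "duhamel U_mult (\<lambda>r. pmult (f' r) (g r)) t n - duhamel U_mult (\<lambda>r. pmult (f' r) (g' r)) t n
     = duhamel U_mult (\<lambda>r. pmult (f' r) (\<lambda>n. g r n - g' r n)) t n"
    unfolding duhamel_diff[OF propagator_U c[OF f' g] c[OF f' g'] t, symmetric]
    by (rule duhamel_cong[OF propagator_U _ _ t, symmetric, OF c[OF f' traj_diff[OF g g']]])
       (rule pmult_diff_right[OF traj_rate traj_le[OF f'] traj_le[OF g] traj_le[OF g']])
  show ?thesis
    unfolding duhamel_u_def 1[symmetric] 2[symmetric] by (simp add: algebra_simps)
qed

lemma duhamel_v_diff:
  assumes f: "traj T A f" and f': "traj T A' f'" and g: "traj T B g" and g': "traj T B' g'" and t: "t \<in> {-T..T}"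
  shows "duhamel_v \<beta> \<gamma> f g t n - duhamel_v \<beta> \<gamma> f' g' t n
    = duhamel_v \<beta> \<gamma> (\<lambda>t n. f t n - f' t n) g t n + duhamel_v \<beta> \<gamma> f' (\<lambda>t n. g t n - g' t n) t n"
proof -
  have c: "continuous_on {-T..T} (\<lambda>r. deriv_mult n * pmult (h r) (pconj (k r)) n)"
    if "traj T a h" "traj T b k" for h k a b n
    by (intro continuous_intros traj_cont[OF traj_pmult[OF that(1) traj_pconj[OF that(2)] T]])
  have pc: "pconj (\<lambda>n. g r n - g' r n) = (\<lambda>n. pconj (g r) n - pconj (g' r) n)" for r
    by (simp add: pconj_def fun_eq_iff)
  have 1: "duhamel (V_mult \<gamma>) (\<lambda>r n. deriv_mult n * pmult (f r) (pconj (g r)) n) t n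
       - duhamel (V_mult \<gamma>) (\<lambda>r n. deriv_mult n * pmult (f' r) (pconj (g r)) n) t n
     = duhamel (V_mult \<gamma>) (\<lambda>r n. deriv_mult n * pmult (\<lambda>n. f r n - f' r n) (pconj (g r)) n) t n"
    unfolding duhamel_diff[OF propagator_V c[OF f g] c[OF f' g] t, symmetric] right_diff_distrib[symmetric]
    by (rule duhamel_cong[OF propagator_V _ _ t, symmetric, OF c[OF traj_diff[OF f f'] g]])
       (simp only: pmult_diff_left[OF traj_rate traj_le[OF f] traj_le[OF f'] traj_le[OF traj_pconj[OF g]]])
  have 2: "duhamel (V_mult \<gamma>) (\<lambda>r n. deriv_mult n * pmult (f' r) (pconj (g r)) n) t n
       - duhamel (V_mult \<gamma>) (\<lambda>r n. deriv_mult n * pmult (f' r) (pconj (g' r)) n) t n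
     = duhamel (V_mult \<gamma>) (\<lambda>r n. deriv_mult n * pmult (f' r) (pconj (\<lambda>n. g r n - g' r n)) n) t n"
    unfolding duhamel_diff[OF propagator_V c[OF f' g] c[OF f' g'] t, symmetric] right_diff_distrib[symmetric]
    by (rule duhamel_cong[OF propagator_V _ _ t, symmetric, OF c[OF f' traj_diff[OF g g']]])
       (simp only: pc pmult_diff_right[OF traj_rate traj_le[OF f'] traj_le[OF traj_pconj[OF g]] traj_le[OF traj_pconj[OF g']]])
  show ?thesis
    unfolding duhamel_v_def 1[symmetric] 2[symmetric] by (simp add: algebra_simps)
qed

text \<open>Iteration from the free solution. The smallness condition reads K A^2 \<le> A / 16:
  iterates stay in the ball of radius 2 A because A + 4 K A^2 \<le> 2 A, and increments at least
  halve because 4 K A \<le> 1/2.\<close>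

lemma picard:
  assumes p: "traj T A p" and q: "traj T A q" and small: "16 * K * A \<le> 1"
  obtains u v where "traj T (2 * A) u" "traj T (2 * A) v"
    and "\<And>t n. t \<in> {-T..T} \<Longrightarrow> u t n = p t n + duhamel_u \<alpha> u v t n"
    and "\<And>t n. t \<in> {-T..T} \<Longrightarrow> v t n = q t n + duhamel_v \<beta> \<gamma> u u t n"
proof -
  have A: "A \<ge> 0" by (rule traj_nonneg[OF p T])
  define Z where "Z = rec_nat (p, q) (\<lambda>_ z.
    (\<lambda>t n. p t n + duhamel_u \<alpha> (fst z) (snd z) t n, \<lambda>t n. q t n + duhamel_v \<beta> \<gamma> (fst z) (fst z) t n))"
  define F where "F k = fst (Z k)" for k
  define G where "G k = snd (Z k)" for k
  have F0: "F 0 = p" and G0: "G 0 = q" by (simp_all add: F_def G_def Z_def)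
  have FS: "F (Suc k) = (\<lambda>t n. p t n + duhamel_u \<alpha> (F k) (G k) t n)"
    and GS: "G (Suc k) = (\<lambda>t n. q t n + duhamel_v \<beta> \<gamma> (F k) (F k) t n)" for k
    by (simp_all add: F_def G_def Z_def)
  have FS': "F (Suc k) t n = p t n + duhamel_u \<alpha> (F k) (G k) t n"
    and GS': "G (Suc k) t n = q t n + duhamel_v \<beta> \<gamma> (F k) (F k) t n" for k t n
    by (simp_all add: FS GS)
  have KA: "K * A * A \<le> A / 16"
    using mult_right_mono[OF small A] by simp
  have bd: "traj T (2 * A) (F k) \<and> traj T (2 * A) (G k)" for k
  proof (induction k)
    case 0 then show ?case using p q A by (auto simp: F0 G0 intro: traj_mono)
  next
    case (Suc k)
    have le: "A + K * (2 * A * (2 * A)) \<le> 2 * A" using KA A by simp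
    have "traj T (A + K * (2 * A * (2 * A))) (F (Suc k))" "traj T (A + K * (2 * A * (2 * A))) (G (Suc k))"
      unfolding FS GS
      using traj_add[OF p traj_duhamel_u] traj_add[OF q traj_duhamel_v] Suc by blast+
    then show ?case using le traj_mono by blast
  qed
  then have F: "traj T (2 * A) (F k)" and G: "traj T (2 * A) (G k)" for k by auto
  have D: "traj T (A / 2 ^ k) (\<lambda>t n. F (Suc k) t n - F k t n) \<and> traj T (A / 2 ^ k) (\<lambda>t n. G (Suc k) t n - G k t n)" for k
  proof (induction k)
    case 0
    have le: "K * (A * A) \<le> A / 2 ^ 0" using KA A by simp
    show ?case
      unfolding FS GS F0 G0 add_diff_cancel_left'
      using traj_mono[OF traj_duhamel_u[OF p q] le] traj_mono[OF traj_duhamel_v[OF p p] le] by simp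
  next
    case (Suc k)
    then have dF: "traj T (A / 2 ^ k) (\<lambda>t n. F (Suc k) t n - F k t n)"
      and dG: "traj T (A / 2 ^ k) (\<lambda>t n. G (Suc k) t n - G k t n)" by auto
    have le: "K * (A / 2 ^ k * (2 * A)) + K * (2 * A * (A / 2 ^ k)) \<le> A / 2 ^ Suc k"
      using divide_right_mono[OF KA, of "2 ^ k"] A by (simp add: field_simps)
    have "traj T (K * (A / 2 ^ k * (2 * A)) + K * (2 * A * (A / 2 ^ k))) (\<lambda>t n. F (Suc (Suc k)) t n - F (Suc k) t n)"
    proof (rule traj_cong[OF traj_add[OF traj_duhamel_u[OF dF G] traj_duhamel_u[OF F dG]]])
      fix t n assume "t \<in> {-T..T}"
      from duhamel_u_diff[OF F[of "Suc k"] F[of k] G[of "Suc k"] G[of k] this, of n]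
      show "F (Suc (Suc k)) t n - F (Suc k) t n = duhamel_u \<alpha> (\<lambda>t n. F (Suc k) t n - F k t n) (G (Suc k)) t n +
          duhamel_u \<alpha> (F k) (\<lambda>t n. G (Suc k) t n - G k t n) t n"
        by (simp add: FS'[of "Suc k" t n] FS'[of k t n])
    qed
    moreover have "traj T (K * (A / 2 ^ k * (2 * A)) + K * (2 * A * (A / 2 ^ k))) (\<lambda>t n. G (Suc (Suc k)) t n - G (Suc k) t n)"
    proof (rule traj_cong[OF traj_add[OF traj_duhamel_v[OF dF F] traj_duhamel_v[OF F dF]]])
      fix t n assume "t \<in> {-T..T}"
      from duhamel_v_diff[OF F[of "Suc k"] F[of k] F[of "Suc k"] F[of k] this, of n]
      show "G (Suc (Suc k)) t n - G (Suc k) t n = duhamel_v \<beta> \<gamma> (\<lambda>t n. F (Suc k) t n - F k t n) (F (Suc k)) t n +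
          duhamel_v \<beta> \<gamma> (F k) (\<lambda>t n. F (Suc k) t n - F k t n) t n"
        by (simp add: GS'[of "Suc k" t n] GS'[of k t n])
    qed
    ultimately show ?case using le traj_mono by blast
  qed
  obtain u where u: "\<And>k. traj T (2 * A / 2 ^ k) (\<lambda>t n. u t n - F k t n)"
    by (rule traj_complete[where F = F and D = A, OF T F]) (use D in auto)
  obtain v where v: "\<And>k. traj T (2 * A / 2 ^ k) (\<lambda>t n. v t n - G k t n)"
    by (rule traj_complete[where F = G and D = A, OF T G]) (use D in auto)
  \<comment> \<open>A preliminary bound, from 2 A for the distance to the initial iterate and 2 A
    for that iterate. It is improved to 2 A once the equations are known.\<close>
  have u4: "traj T (4 * A) u" and v4: "traj T (4 * A) v"
    using traj_add[OF u F, of 0 0] traj_add[OF v G, of 0 0] by simp_all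
  \<comment> \<open>The residual is the error of \<open>F (Suc k)\<close> minus the difference of
    the Duhamel terms at the limit and at step \<open>k\<close>; each is of size 1 / 2^k.\<close>
  have ueq: "u t n - (p t n + duhamel_u \<alpha> u v t n) = 0" if "t \<in> {-T..T}" for t n
  proof (rule traj_vanish[OF _ that, of "A + K * (2 * A * (4 * A)) + K * (2 * A * (2 * A))"])
    fix k
    have "traj T (2 * A / 2 ^ Suc k + (K * (2 * A / 2 ^ k * (4 * A)) + K * (2 * A * (2 * A / 2 ^ k)))) (\<lambda>t n. u t n - (p t n + duhamel_u \<alpha> u v t n))"
    proof (rule traj_cong[OF traj_diff[OF u[of "Suc k"] traj_add[OF traj_duhamel_u[OF u v4] traj_duhamel_u[OF F v]]]])
      fix t n assume "t \<in> {-T..T}"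
      from duhamel_u_diff[OF u4 F[of k] v4 G[of k] this, of n]
      show "u t n - (p t n + duhamel_u \<alpha> u v t n) = u t n - F (Suc k) t n -
          (duhamel_u \<alpha> (\<lambda>t n. u t n - F k t n) v t n + duhamel_u \<alpha> (F k) (\<lambda>t n. v t n - G k t n) t n)"
        by (simp add: FS' algebra_simps)
    qed
    then show "traj T ((A + K * (2 * A * (4 * A)) + K * (2 * A * (2 * A))) / 2 ^ k) (\<lambda>t n. u t n - (p t n + duhamel_u \<alpha> u v t n))"
      by (rule traj_mono) (simp add: field_simps)
  qed
  have veq: "v t n - (q t n + duhamel_v \<beta> \<gamma> u u t n) = 0" if "t \<in> {-T..T}" for t n
  proof (rule traj_vanish[OF _ that, of "A + K * (2 * A * (4 * A)) + K * (2 * A * (2 * A))"])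
    fix k
    have "traj T (2 * A / 2 ^ Suc k + (K * (2 * A / 2 ^ k * (4 * A)) + K * (2 * A * (2 * A / 2 ^ k)))) (\<lambda>t n. v t n - (q t n + duhamel_v \<beta> \<gamma> u u t n))"
    proof (rule traj_cong[OF traj_diff[OF v[of "Suc k"] traj_add[OF traj_duhamel_v[OF u u4] traj_duhamel_v[OF F u]]]])
      fix t n assume "t \<in> {-T..T}"
      from duhamel_v_diff[OF u4 F[of k] u4 F[of k] this, of n]
      show "v t n - (q t n + duhamel_v \<beta> \<gamma> u u t n) = v t n - G (Suc k) t n -
          (duhamel_v \<beta> \<gamma> (\<lambda>t n. u t n - F k t n) u t n + duhamel_v \<beta> \<gamma> (F k) (\<lambda>t n. u t n - F k t n) t n)"
        by (simp add: GS' algebra_simps)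
    qed
    then show "traj T ((A + K * (2 * A * (4 * A)) + K * (2 * A * (2 * A))) / 2 ^ k) (\<lambda>t n. v t n - (q t n + duhamel_v \<beta> \<gamma> u u t n))"
      by (rule traj_mono) (simp add: field_simps)
  qed
  \<comment> \<open>Reinserting the preliminary bound 4 A into the equations; this step is where the
    constant 16 comes from.\<close>
  have le: "A + K * (4 * A * (4 * A)) \<le> 2 * A" using KA A by simp
  show ?thesis
  proof (rule that)
    show "traj T (2 * A) u"
      by (rule traj_cong[OF traj_mono[OF traj_add[OF p traj_duhamel_u[OF u4 v4]] le]]) (use ueq in auto)
    show "traj T (2 * A) v"
      by (rule traj_cong[OF traj_mono[OF traj_add[OF q traj_duhamel_v[OF u4 u4]] le]]) (use veq in auto)
  qed (use ueq veq in auto)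
qed

text \<open>By the equations, u - p and v - q are of size 4 K A^2. Replacing \<open>u\<close>,
  \<open>v\<close> by \<open>p\<close>, \<open>q\<close> in the Duhamel term thus costs 8 K^2 A^3
  for the first factor, with \<open>v\<close> of size 2 A, and 4 K^2 A^3 for the second, with
  \<open>p\<close> of size A.\<close>

lemma picard_expansion:
  assumes p: "traj T A p" and q: "traj T A q" and u: "traj T (2 * A) u" and v: "traj T (2 * A) v"
    and ueq: "\<And>t n. t \<in> {-T..T} \<Longrightarrow> u t n = p t n + duhamel_u \<alpha> u v t n"
    and veq: "\<And>t n. t \<in> {-T..T} \<Longrightarrow> v t n = q t n + duhamel_v \<beta> \<gamma> u u t n"
    and t: "t \<in> {-T..T}"
  shows "cmod (u t n - p t n - duhamel_u \<alpha> p q t n) \<le> 12 * K\<^sup>2 * A ^ 3"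
proof -
  have du: "traj T (K * (2 * A * (2 * A))) (\<lambda>t n. u t n - p t n)"
    by (rule traj_cong[OF traj_duhamel_u[OF u v]]) (simp add: ueq)
  have dv: "traj T (K * (2 * A * (2 * A))) (\<lambda>t n. v t n - q t n)"
    by (rule traj_cong[OF traj_duhamel_v[OF u u]]) (simp add: veq)
  define E where "E t n = duhamel_u \<alpha> (\<lambda>t n. u t n - p t n) v t n + duhamel_u \<alpha> p (\<lambda>t n. v t n - q t n) t n" for t n
  have "traj T (K * (K * (2 * A * (2 * A)) * (2 * A)) + K * (A * (K * (2 * A * (2 * A))))) E"
    unfolding E_def by (rule traj_add[OF traj_duhamel_u[OF du v] traj_duhamel_u[OF p dv]])
  then have E: "traj T (12 * K\<^sup>2 * A ^ 3) E"
    by (rule traj_mono) (simp add: power2_eq_square power3_eq_cube)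
  have "u t n - p t n - duhamel_u \<alpha> p q t n = E t n"
    using duhamel_u_diff[OF u p v q t, of n] ueq[OF t, of n] by (simp add: E_def)
  then have "cmod (u t n - p t n - duhamel_u \<alpha> p q t n) \<le> 12 * K\<^sup>2 * A ^ 3 * wgt (T + 1 - \<bar>t\<bar>) n"
    using traj_le[OF E t] by simp
  also have "\<dots> \<le> 12 * K\<^sup>2 * A ^ 3"
    using traj_nonneg[OF E T] t by (intro mult_left_le wgt_le_1) auto
  finally show ?thesis .
qed

end


section \<open>Smooth solutions\<close>

lemma jb_ge_1: "jb n \<ge> 1"
  by (simp add: jb_def)

lemma jb_le: "jb n \<le> 1 + \<bar>of_int n\<bar>"
proof -
  have "1 + (real_of_int n)\<^sup>2 \<le> (1 + \<bar>of_int n\<bar>)\<^sup>2"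
    by (simp add: power2_eq_square algebra_simps)
  then show ?thesis unfolding jb_def by (intro real_le_lsqrt) auto
qed

text \<open>Exponential decay beats every power: 1 + x \<le> p exp (x / p) gives (1 + x)^p \<le> p^p
  exp x, and the squared weight contains enough decay to absorb exp x and still leave the summable
  \<open>wgt 0\<close>.\<close>

lemma sobolev_majorant_summable:
  "(\<lambda>n. jb n powr (2 * \<sigma>) * (A * wgt 1 n)\<^sup>2) summable_on UNIV"
proof -
  \<comment> \<open>The exponent 2 \<sigma> may be negative or small; it is raised to at least 1,
    which is harmless since \<open>jb n\<close> is at least 1.\<close>
  define p where "p = max 1 (2 * \<bar>\<sigma>\<bar>)"
  have p: "p \<ge> 1" "2 * \<sigma> \<le> p" by (auto simp: p_def)
  show ?thesis
  proof (rule summable_on_comparison_test)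
    show "(\<lambda>n. p powr p * A\<^sup>2 * wgt 0 n) summable_on UNIV"
      by (intro summable_on_cmult_right wgt_summable) simp
    fix n :: int
    define x where "x = \<bar>real_of_int n\<bar>"
    have x: "x \<ge> 0" by (simp add: x_def)
    have "1 + x \<le> p * (1 + x / p)" using p(1) by (simp add: field_simps)
    also have "\<dots> \<le> p * exp (x / p)" using p(1) by (intro mult_left_mono exp_ge_add_one_self) auto
    finally have 1: "1 + x \<le> p * exp (x / p)" .
    have "jb n powr (2 * \<sigma>) \<le> jb n powr p"
      using p jb_ge_1 by (intro powr_mono) auto
    also have "\<dots> \<le> (p * exp (x / p)) powr p"
      using p order.trans[OF jb_le 1[unfolded x_def]] jb_pos[of n] by (intro powr_mono2) (auto simp: x_def)
    also have "\<dots> = p powr p * exp x"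
      using p(1) by (simp add: powr_mult exp_powr_real)
    finally have j: "jb n powr (2 * \<sigma>) \<le> p powr p * exp x" .
    have w: "wgt 1 n = exp (- x) * wgt 0 n" by (simp add: wgt_def x_def)
    have "(wgt 1 n)\<^sup>2 = (exp (- x) * exp (- x)) * (wgt 0 n * wgt 0 n)"
      by (simp add: w power2_eq_square mult_ac)
    also have "\<dots> \<le> (exp (- x) * 1) * (wgt 0 n * 1)"
      using x wgt_le_1[of 0 n] by (intro mult_mono) auto
    finally have w2: "A\<^sup>2 * (wgt 1 n)\<^sup>2 \<le> A\<^sup>2 * (exp (- x) * wgt 0 n)" by (intro mult_left_mono) auto
    have "jb n powr (2 * \<sigma>) * (A\<^sup>2 * (wgt 1 n)\<^sup>2) \<le> (p powr p * exp x) * (A\<^sup>2 * (exp (- x) * wgt 0 n))"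
      by (rule mult_mono[OF j w2]) auto
    also have "\<dots> = p powr p * A\<^sup>2 * wgt 0 n * (exp x * exp (- x))" by (simp add: mult_ac)
    also have "exp x * exp (- x) = 1" by (simp add: exp_add[symmetric])
    finally show "jb n powr (2 * \<sigma>) * (A * wgt 1 n)\<^sup>2 \<le> p powr p * A\<^sup>2 * wgt 0 n"
      by (simp add: power_mult_distrib)
  qed simp
qed

section \<open>Analytic trajectories as continuous curves in Sobolev spaces\<close>

lemma ell2_nth_diff: "ell2_nth (a - b) n = ell2_nth a n - ell2_nth b n"
  unfolding minus_ell2_def uminus_ell2_def plus_ell2.rep_eq scaleR_ell2.rep_eq by simp

lemma herm_emb_diff: "herm_emb (a - b) = herm_emb a - herm_emb b"
  unfolding minus_herm_ell2_def uminus_herm_ell2_def plus_herm_ell2.rep_eq scaleR_herm_ell2.rep_eq by simp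

text \<open>With a summable majorant of the squared moduli, the squared distance to a fixed point of
  the curve is a uniformly convergent series of continuous functions of \<open>t\<close>, so it
  tends to its value 0.\<close>

lemma continuous_on_ell2:
  fixes f :: "real \<Rightarrow> ell2"
  assumes cont: "\<And>n. continuous_on S (\<lambda>t. ell2_nth (f t) n)"
    and le: "\<And>t n. t \<in> S \<Longrightarrow> (cmod (ell2_nth (f t) n))\<^sup>2 \<le> M n" and M: "M summable_on UNIV"
  shows "continuous_on S f"
  unfolding continuous_on_def
proof
  fix t0 assume t0: "t0 \<in> S"
  define h where "h t = (\<Sum>\<^sub>\<infinity>n. (cmod (ell2_nth (f t) n - ell2_nth (f t0) n))\<^sup>2)" for t
  have "continuous_on S h"
    unfolding h_def
  proof (rule continuous_on_infsum)
    show "(\<lambda>n. 4 * M n) summable_on UNIV" by (intro summable_on_cmult_right M)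
    fix n t assume t: "t \<in> S"
    have "(cmod (ell2_nth (f t) n - ell2_nth (f t0) n))\<^sup>2 \<le> (cmod (ell2_nth (f t) n) + cmod (ell2_nth (f t0) n))\<^sup>2"
      by (intro power_mono norm_triangle_ineq4) auto
    also have "\<dots> \<le> 2 * (cmod (ell2_nth (f t) n))\<^sup>2 + 2 * (cmod (ell2_nth (f t0) n))\<^sup>2"
      using sum_squares_bound[of "cmod (ell2_nth (f t) n)" "cmod (ell2_nth (f t0) n)"]
      by (simp add: power2_eq_square algebra_simps)
    also have "\<dots> \<le> 4 * M n" using le[OF t, of n] le[OF t0, of n] by simp
    finally show "norm ((cmod (ell2_nth (f t) n - ell2_nth (f t0) n))\<^sup>2) \<le> 4 * M n" by simp
  qed (intro continuous_intros cont)
  then have "(h \<longlongrightarrow> h t0) (at t0 within S)" using t0 by (simp add: continuous_on_def)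
  then have "((\<lambda>t. sqrt (h t)) \<longlongrightarrow> sqrt (h t0)) (at t0 within S)" by (rule tendsto_real_sqrt)
  moreover have "sqrt (h t) = dist (f t) (f t0)" for t
  proof -
    have "(dist (f t) (f t0))\<^sup>2 = h t"
      unfolding dist_norm ell2_norm_sq ell2_nth_diff h_def ..
    then show ?thesis by (metis real_sqrt_abs abs_of_nonneg zero_le_dist)
  qed
  moreover have "h t0 = 0" by (simp add: h_def)
  ultimately show "(f \<longlongrightarrow> f t0) (at t0 within S)"
    by (subst tendsto_dist_iff) simp
qed

lemma from_to_ell2: "w \<in> sbo_space s \<Longrightarrow> from_ell2 s (to_ell2 s w) = w"
  unfolding to_ell2_def
  by (metis bij_betw_from_ell2 bij_betw_inv_into_right)

lemma to_from_ell2: "to_ell2 s (from_ell2 s z) = z"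
  unfolding to_ell2_def
  by (metis UNIV_I bij_betw_from_ell2 bij_betw_inv_into_left)

lemma ell2_nth_to_ell2:
  assumes "w \<in> sbo_space s"
  shows "ell2_nth (fst (to_ell2 s w)) n = of_real (jb n powr s) * fst w n"
    and "ell2_nth (herm_emb (snd (to_ell2 s w))) n = of_real (jb n powr (s - 1/2)) * snd w n"
proof -
  have "fst w n = of_real (jb n powr (- s)) * ell2_nth (fst (to_ell2 s w)) n"
    and "snd w n = of_real (jb n powr (- (s - 1/2))) * ell2_nth (herm_emb (snd (to_ell2 s w))) n"
    by (subst from_to_ell2[OF assms, symmetric], simp only: from_ell2_def fst_conv snd_conv)+
  then show "ell2_nth (fst (to_ell2 s w)) n = of_real (jb n powr s) * fst w n"
    and "ell2_nth (herm_emb (snd (to_ell2 s w))) n = of_real (jb n powr (s - 1/2)) * snd w n"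
    by (simp_all only: jb_cancel)
qed

text \<open>As \<sigma> is arbitrary, this puts the constructed solutions into every uniqueness
  class allowed by \<open>sbo_wellposed\<close>.\<close>

lemma traj_cont_curve:
  assumes u: "traj T A u" and v: "traj T B v" and h: "\<And>t. t \<in> {-T..T} \<Longrightarrow> hermitian (v t)"
  shows "cont_curve \<sigma> T (\<lambda>t. (u t, v t))"
proof -
  have bd: "jb n powr (2 * \<tau>) * (cmod (f t n))\<^sup>2 \<le> jb n powr (2 * \<tau>) * (C * wgt 1 n)\<^sup>2"
    if "traj T C f" "t \<in> {-T..T}" for C f t n \<tau>
    by (intro mult_left_mono power_mono traj_le_uniform[OF that]) auto
  have mem: "f t \<in> sobolev \<tau>" if "traj T C f" "t \<in> {-T..T}" for C f t \<tau>
    unfolding sobolev_def mem_Collect_eq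
    by (rule summable_on_comparison_test[OF sobolev_majorant_summable bd[OF that]]) auto
  have sp: "(u t, v t) \<in> sbo_space \<sigma>" if "t \<in> {-T..T}" for t
    using that mem[OF u] mem[OF v] h by (simp add: sbo_space_def)
  have "continuous_on {-T..T} (\<lambda>t. fst (to_ell2 \<sigma> (u t, v t)))"
  proof (rule continuous_on_ell2)
    fix n
    show "continuous_on {-T..T} (\<lambda>t. ell2_nth (fst (to_ell2 \<sigma> (u t, v t))) n)"
      by (subst continuous_on_cong[OF refl ell2_nth_to_ell2(1)[OF sp]])
         (auto intro!: continuous_intros traj_cont[OF u])
    fix t assume t: "t \<in> {-T..T}"
    show "(cmod (ell2_nth (fst (to_ell2 \<sigma> (u t, v t))) n))\<^sup>2 \<le> jb n powr (2 * \<sigma>) * (A * wgt 1 n)\<^sup>2"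
      unfolding ell2_nth_to_ell2(1)[OF sp[OF t]] jb_weight_sq fst_conv by (rule bd[OF u t])
  qed (rule sobolev_majorant_summable)
  moreover have "continuous_on {-T..T} (\<lambda>t. herm_emb (snd (to_ell2 \<sigma> (u t, v t))))"
  proof (rule continuous_on_ell2)
    fix n
    show "continuous_on {-T..T} (\<lambda>t. ell2_nth (herm_emb (snd (to_ell2 \<sigma> (u t, v t)))) n)"
      by (subst continuous_on_cong[OF refl ell2_nth_to_ell2(2)[OF sp]])
         (auto intro!: continuous_intros traj_cont[OF v])
    fix t assume t: "t \<in> {-T..T}"
    show "(cmod (ell2_nth (herm_emb (snd (to_ell2 \<sigma> (u t, v t)))) n))\<^sup>2
        \<le> jb n powr (2 * (\<sigma> - 1/2)) * (B * wgt 1 n)\<^sup>2"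
      unfolding ell2_nth_to_ell2(2)[OF sp[OF t]] jb_weight_sq snd_conv by (rule bd[OF v t])
  qed (rule sobolev_majorant_summable)
  then have "continuous_on {-T..T} (\<lambda>t. snd (to_ell2 \<sigma> (u t, v t)))"
    unfolding continuous_on_iff dist_norm herm_emb_diff[symmetric] norm_herm_ell2.rep_eq[symmetric] .
  ultimately have "continuous_on {-T..T} (\<lambda>t. (fst (to_ell2 \<sigma> (u t, v t)), snd (to_ell2 \<sigma> (u t, v t))))"
    by (rule continuous_on_Pair)
  then show ?thesis
    unfolding cont_curve_def using sp by auto
qed

section \<open>Reality of the second component and identification with the solution map\<close>

lemma duhamel_cnj:
  assumes m: "propagator m" and f: "\<And>n. continuous_on {-T..T} (\<lambda>r. f r n)" and t: "t \<in> {-T..T}"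
    and ms: "\<And>t. m t (- n) = cnj (m t n)"
    and fs: "\<And>r. r \<in> {-T..T} \<Longrightarrow> f r (- n) = cnj (f r n)"
  shows "duhamel m f t (- n) = cnj (duhamel m f t n)"
proof -
  have "duhamel m f t (- n) = integral {0..1} (\<lambda>x. cnj (of_real t * (m (t - t * x) n * f (t * x) n)))"
    unfolding duhamel_scaled[OF m f t] by (rule integral_cong) (simp add: ms fs[OF scaled_mem[OF t]])
  also have "\<dots> = cnj (integral {0..1} (\<lambda>x. of_real t * (m (t - t * x) n * f (t * x) n)))"
    by (rule integral_cnj[symmetric])
  finally show ?thesis unfolding duhamel_scaled[OF m f t] .
qed

lemma V_mult_minus: "V_mult \<gamma> t (- n) = cnj (V_mult \<gamma> t n)"
  unfolding V_mult_def deriv_mult_def hilbert_mult_def exp_cnj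
  by (simp add: sgn_minus power_mult_distrib)

text \<open>The Fourier side of the fact that |f|^2 is real; the substitution k = n + j exchanges
  the two factors.\<close>

lemma pmult_pconj_minus: "pmult f (pconj f) (- n) = cnj (pmult f (pconj f) n)"
proof -
  have bij: "bij_betw (\<lambda>j::int. n + j) UNIV UNIV"
    by (rule bij_betwI[where g = "\<lambda>k. k - n"]) auto
  have "cnj (pmult f (pconj f) n) = (\<Sum>\<^sub>\<infinity>k. cnj (f (n - k)) * f (- k))"
    unfolding pmult_def pconj_def infsum_cnj[symmetric] by simp
  also have "\<dots> = (\<Sum>\<^sub>\<infinity>j. cnj (f (n - (n + j))) * f (- (n + j)))"
    by (rule infsum_reindex_bij_betw[OF bij, symmetric])
  also have "\<dots> = pmult f (pconj f) (- n)"
    unfolding pmult_def pconj_def by (simp add: mult.commute)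
  finally show ?thesis by simp
qed

lemma pconj_trunc: "pconj (trunc N f) = trunc N (pconj f)"
  by (auto simp: pconj_def trunc_def)

context sbo
begin

lemma hermitian_duhamel_v:
  assumes "traj T A f" "t \<in> {-T..T}"
  shows "hermitian (duhamel_v \<beta> \<gamma> f f t)"
  unfolding hermitian_def duhamel_v_def
proof
  fix n
  have "duhamel (V_mult \<gamma>) (\<lambda>r n. deriv_mult n * pmult (f r) (pconj (f r)) n) t (- n)
    = cnj (duhamel (V_mult \<gamma>) (\<lambda>r n. deriv_mult n * pmult (f r) (pconj (f r)) n) t n)"
    by (rule duhamel_cnj[OF propagator_V _ assms(2) V_mult_minus])
       (auto intro!: continuous_intros traj_cont[OF traj_pmult[OF assms(1) traj_pconj[OF assms(1)] T]]
         simp: pmult_pconj_minus deriv_mult_def)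
  then show "of_real \<beta> * duhamel (V_mult \<gamma>) (\<lambda>r n. deriv_mult n * pmult (f r) (pconj (f r)) n) t (- n)
    = cnj (of_real \<beta> * duhamel (V_mult \<gamma>) (\<lambda>r n. deriv_mult n * pmult (f r) (pconj (f r)) n) t n)"
    by simp
qed

lemma traj_solution:
  assumes u: "traj T A u" and v: "traj T B v"
    and ueq: "\<And>t n. t \<in> {-T..T} \<Longrightarrow> u t n = U_mult t n * \<phi> n + duhamel_u \<alpha> u v t n"
    and veq: "\<And>t n. t \<in> {-T..T} \<Longrightarrow> v t n = V_mult \<gamma> t n * \<psi> n + duhamel_v \<beta> \<gamma> u u t n"
  shows "sbo_solution \<alpha> \<beta> \<gamma> T (\<phi>, \<psi>) (\<lambda>t. (u t, v t))"
proof -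
  \<comment> \<open>Covers both equations at once: \<open>c\<close> is 1 for the first and the
    symbol of the derivative for the second.\<close>
  have lim: "(\<lambda>N. duhamel m (\<lambda>r n. c n * pmult (trunc N (f r)) (trunc N (g r)) n) t n)
      \<longlonglongrightarrow> duhamel m (\<lambda>r n. c n * pmult (f r) (g r) n) t n"
    if m: "propagator m" and f: "traj T A' f" and g: "traj T B' g" and t: "t \<in> {-T..T}" for m f g t n c A' B'
  proof (rule duhamel_tendsto[OF m _ _ t])
    note fgN = traj_pmult[OF traj_trunc[OF f T] traj_trunc[OF g T] T]
    show "continuous_on {-T..T} (\<lambda>r. c n * pmult (trunc N (f r)) (trunc N (g r)) n)" for N
      by (intro continuous_intros traj_cont[OF fgN])
    show "continuous_on {-T..T} (\<lambda>r. c n * pmult (f r) (g r) n)"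
      by (intro continuous_intros traj_cont[OF traj_pmult[OF f g T]])
    show "cmod (c n * pmult (trunc N (f r)) (trunc N (g r)) n) \<le> cmod (c n) * (A' * B' * conv_const * wgt 1 n)"
      if "r \<in> {-T..T}" for N r
      unfolding norm_mult by (intro mult_left_mono traj_le_uniform[OF fgN that]) auto
    show "(\<lambda>N. c n * pmult (trunc N (f r)) (trunc N (g r)) n) \<longlonglongrightarrow> c n * pmult (f r) (g r) n"
      if "r \<in> {-T..T}" for r
      by (intro tendsto_mult tendsto_const pmult_trunc_tendsto[OF traj_rate[OF that] traj_le[OF f that] traj_le[OF g that]])
  qed
  show ?thesis
    unfolding sbo_solution_def fst_conv snd_conv
  proof (intro ballI allI conjI)
    fix t n assume t: "t \<in> {-T..T}"
    have "(\<lambda>N. U_mult t n * \<phi> n + - \<i> * of_real \<alpha> * duhamel U_mult (\<lambda>r n. 1 * pmult (trunc N (u r)) (trunc N (v r)) n) t n)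
      \<longlonglongrightarrow> U_mult t n * \<phi> n + - \<i> * of_real \<alpha> * duhamel U_mult (\<lambda>r n. 1 * pmult (u r) (v r) n) t n"
      by (intro tendsto_add tendsto_mult tendsto_const lim[OF propagator_U u v t])
    then show "(\<lambda>N. U_mult t n * \<phi> n - \<i> * of_real \<alpha> *
          (LBINT r=0..t. U_mult (t - r) n * pmult (trunc N (u r)) (trunc N (v r)) n)) \<longlonglongrightarrow> u t n"
      by (simp add: ueq[OF t] duhamel_u_def duhamel_def)
    have "(\<lambda>N. V_mult \<gamma> t n * \<psi> n + of_real \<beta> * duhamel (V_mult \<gamma>) (\<lambda>r n. deriv_mult n * pmult (trunc N (u r)) (trunc N (pconj (u r))) n) t n)
      \<longlonglongrightarrow> V_mult \<gamma> t n * \<psi> n + of_real \<beta> * duhamel (V_mult \<gamma>) (\<lambda>r n. deriv_mult n * pmult (u r) (pconj (u r)) n) t n"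
      by (intro tendsto_add tendsto_mult tendsto_const lim[OF propagator_V u traj_pconj[OF u] t])
    then show "(\<lambda>N. V_mult \<gamma> t n * \<psi> n + of_real \<beta> *
          (LBINT r=0..t. V_mult \<gamma> (t - r) n * (deriv_mult n * pmult (trunc N (u r)) (pconj (trunc N (u r))) n))) \<longlonglongrightarrow> v t n"
      by (simp add: veq[OF t] duhamel_v_def duhamel_def pconj_trunc)
  qed
qed

text \<open>Since \<Phi> is known only through well-posedness, the expansion is proved for the
  analytic solution with the same data, which exists on the whole of [-T, T] by
  \<open>picard\<close> and is Hermitian in its second component.\<close>

lemma wellposed_expansion:
  assumes wp: "sbo_wellposed \<alpha> \<beta> \<gamma> s T D \<Phi>" and mem: "(\<phi>, \<psi>) \<in> D"
    and \<phi>: "\<And>n. cmod (\<phi> n) \<le> A * wgt (T + 1) n" and \<psi>: "\<And>n. cmod (\<psi> n) \<le> A * wgt (T + 1) n"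
    and \<psi>h: "hermitian \<psi>" and A: "A \<ge> 0" and small: "16 * K * A \<le> 1" and t: "t \<in> {-T..T}"
  shows "cmod (fst (\<Phi> t (\<phi>, \<psi>)) n - U_mult t n * \<phi> n
      - duhamel_u \<alpha> (\<lambda>t n. U_mult t n * \<phi> n) (\<lambda>t n. V_mult \<gamma> t n * \<psi> n) t n) \<le> 12 * K\<^sup>2 * A ^ 3"
proof -
  define p where "p = (\<lambda>t n. U_mult t n * \<phi> n)"
  define q where "q = (\<lambda>t n. V_mult \<gamma> t n * \<psi> n)"
  have p: "traj T A p" and q: "traj T A q"
    unfolding p_def q_def using traj_free propagator_U propagator_V \<phi> \<psi> A by blast+
  from picard[OF p q small] obtain u v where u: "traj T (2 * A) u" and v: "traj T (2 * A) v"
    and ueq: "\<And>t n. t \<in> {-T..T} \<Longrightarrow> u t n = p t n + duhamel_u \<alpha> u v t n"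
    and veq: "\<And>t n. t \<in> {-T..T} \<Longrightarrow> v t n = q t n + duhamel_v \<beta> \<gamma> u u t n"
    by blast
  have "hermitian (v t)" if "t \<in> {-T..T}" for t
    using hermitian_duhamel_v[OF u that] \<psi>h
    by (simp add: hermitian_def veq[OF that] q_def V_mult_minus)
  then have curve: "\<forall>\<sigma>. cont_curve \<sigma> T (\<lambda>t. (u t, v t))"
    using traj_cont_curve[OF u v] by blast
  have sol: "sbo_solution \<alpha> \<beta> \<gamma> T (\<phi>, \<psi>) (\<lambda>t. (u t, v t))"
    by (rule traj_solution[OF u v]) (use ueq veq in \<open>auto simp: p_def q_def\<close>)
  \<comment> \<open>Uniqueness: the analytic curve is continuous into every Sobolev space, hence
    belongs to the class in which \<Phi> is the only solution.\<close>
  have "(u t, v t) = \<Phi> t (\<phi>, \<psi>)"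
    using wp mem curve sol t unfolding sbo_wellposed_def by blast
  then have "fst (\<Phi> t (\<phi>, \<psi>)) n = u t n" by (metis fst_conv)
  with picard_expansion[OF p q u v ueq veq t, of n] show ?thesis
    by (simp add: p_def q_def)
qed

end


section \<open>Second-order expansion of the solution map\<close>

text \<open>Differentiability of \<open>F'\<close> at the origin gives |F' y - F' 0| \<le> C |y|
  with C = |F'' 0| + 1; the mean value inequality for F - F' 0 on the ball of radius |y| then gives
  the quadratic remainder.\<close>

lemma C2_on_taylor:
  fixes F :: "'a::real_normed_vector \<Rightarrow> 'b::real_normed_vector"
  assumes "C2_on A F" "open A" "0 \<in> A"
  obtains L C \<delta> where "bounded_linear L" "\<delta> > 0"
    "\<And>y. norm y < \<delta> \<Longrightarrow> norm (F y - F 0 - L y) \<le> C * (norm y)\<^sup>2"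
proof -
  obtain F' F'' where F': "\<And>x. x \<in> A \<Longrightarrow> (F has_derivative blinfun_apply (F' x)) (at x)"
    and F'': "\<And>x. x \<in> A \<Longrightarrow> (F' has_derivative blinfun_apply (F'' x)) (at x)"
    using assms(1) unfolding C2_on_def by blast
  define C where "C = norm (F'' 0) + 1"
  obtain d where d: "d > 0" and dle: "\<And>y. norm y < d \<Longrightarrow> norm (F' y - F' 0 - F'' 0 y) \<le> norm y"
    using F''[OF assms(3)] unfolding has_derivative_at_alt by (metis diff_zero mult_1 zero_less_one)
  obtain e where e: "e > 0" "ball 0 e \<subseteq> A"
    using assms(2,3) open_contains_ball by blast
  have lip: "norm (F' y - F' 0) \<le> C * norm y" if "norm y < d" for y
  proof -
    have "norm (F' y - F' 0) \<le> norm (F' y - F' 0 - F'' 0 y) + norm (F'' 0 y)"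
      by (metis diff_add_cancel norm_triangle_ineq)
    also have "\<dots> \<le> norm y + norm (F'' 0) * norm y"
      by (intro add_mono dle that norm_blinfun)
    finally show ?thesis by (simp add: C_def algebra_simps)
  qed
  have "norm (F y - F 0 - F' 0 y) \<le> C * (norm y)\<^sup>2" if y: "norm y < min d e" for y
  proof -
    define G where "G x = F x - F' 0 x" for x
    have "norm (G y - G 0) \<le> (C * norm y) * norm (y - 0)"
    proof (rule differentiable_bound[where S = "cball 0 (norm y)" and f' = "\<lambda>x. blinfun_apply (F' x - F' 0)"])
      fix x assume x: "x \<in> cball (0::'a) (norm y)"
      then have "x \<in> A" using y e(2) by (auto simp: subset_iff)
      from has_derivative_diff[OF F'[OF this] bounded_linear_imp_has_derivative[OF blinfun.bounded_linear_right[of "F' 0"]]]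
      show "(G has_derivative blinfun_apply (F' x - F' 0)) (at x within cball 0 (norm y))"
        unfolding G_def blinfun.diff_left by (rule has_derivative_at_withinI)
      have "onorm (blinfun_apply (F' x - F' 0)) = norm (F' x - F' 0)" by (simp add: norm_blinfun.rep_eq)
      also have "\<dots> \<le> C * norm x" using x y by (intro lip) auto
      also have "\<dots> \<le> C * norm y" using x by (intro mult_left_mono) (auto simp: C_def)
      finally show "onorm (blinfun_apply (F' x - F' 0)) \<le> C * norm y" .
    qed auto
    then show ?thesis by (simp add: G_def power2_eq_square algebra_simps blinfun.zero_right)
  qed
  then show ?thesis
    using that[of "blinfun_apply (F' 0)" "min d e" C] d e(1) blinfun.bounded_linear_right by auto
qed

text \<open>Comparison of coefficients: letting \<epsilon> tend to 0 from the right forces c = 0;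
  dividing by \<epsilon> and repeating forces d = 0; after a second division the limit bounds e. The
  cubic error drops out, whatever its constant \<open>B\<close>.\<close>

lemma second_coeff_le:
  fixes c d e :: complex and M B :: real
  assumes "\<epsilon>0 > 0"
    and le: "\<And>\<epsilon>. 0 < \<epsilon> \<Longrightarrow> \<epsilon> < \<epsilon>0 \<Longrightarrow>
      cmod (c + of_real \<epsilon> * d + of_real (\<epsilon>\<^sup>2) * e) \<le> M * \<epsilon>\<^sup>2 + B * \<epsilon> ^ 3"
  shows "cmod e \<le> M"
proof -
  have le0: "f 0 \<le> g 0"
    if "continuous_on UNIV f" "continuous_on UNIV g" "\<And>\<epsilon>. 0 < \<epsilon> \<Longrightarrow> \<epsilon> < \<epsilon>0 \<Longrightarrow> f \<epsilon> \<le> g \<epsilon>" for f g :: "real \<Rightarrow> real"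
  proof (rule tendsto_le[OF trivial_limit_at_right_real])
    show "(f \<longlongrightarrow> f 0) (at_right 0)" "(g \<longlongrightarrow> g 0) (at_right 0)"
      using that(1,2) by (auto simp: continuous_on_def filterlim_at_split)
    show "\<forall>\<^sub>F \<epsilon> in at_right 0. f \<epsilon> \<le> g \<epsilon>"
      using assms(1) that(3) unfolding eventually_at_right_field by blast
  qed
  have "cmod (c + of_real 0 * d + of_real (0\<^sup>2) * e) \<le> M * 0\<^sup>2 + B * 0 ^ 3"
    by (rule le0[OF _ _ le]) (intro continuous_intros)+
  then have c: "c = 0" by simp
  have le1: "cmod (d + of_real \<epsilon> * e) \<le> M * \<epsilon> + B * \<epsilon>\<^sup>2" if \<epsilon>: "0 < \<epsilon>" "\<epsilon> < \<epsilon>0" for \<epsilon>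
  proof -
    have "\<epsilon> * cmod (d + of_real \<epsilon> * e) = cmod (of_real \<epsilon> * (d + of_real \<epsilon> * e))"
      using \<epsilon> by (simp add: norm_mult)
    also have "\<dots> \<le> \<epsilon> * (M * \<epsilon> + B * \<epsilon>\<^sup>2)"
      using le[OF \<epsilon>] c by (simp add: power2_eq_square power3_eq_cube algebra_simps)
    finally show ?thesis using \<epsilon> by simp
  qed
  have "cmod (d + of_real 0 * e) \<le> M * 0 + B * 0\<^sup>2"
    by (rule le0[OF _ _ le1]) (intro continuous_intros)+
  then have d: "d = 0" by simp
  have le2: "cmod e \<le> M + B * \<epsilon>" if \<epsilon>: "0 < \<epsilon>" "\<epsilon> < \<epsilon>0" for \<epsilon>
  proof -
    have "\<epsilon> * cmod e \<le> \<epsilon> * (M + B * \<epsilon>)"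
      using le1[OF \<epsilon>] d \<epsilon> by (simp add: norm_mult power2_eq_square algebra_simps)
    then show ?thesis using \<epsilon> by simp
  qed
  have "cmod e \<le> M + B * 0"
    by (rule le0[OF _ _ le2]) (intro continuous_intros)+
  then show ?thesis by simp
qed

lemma ell2_nth_le_norm: "cmod (ell2_nth a n) \<le> norm a"
proof -
  have "(\<Sum>n\<in>{n}. (cmod (ell2_nth a n))\<^sup>2) \<le> (\<Sum>\<^sub>\<infinity>n. (cmod (ell2_nth a n))\<^sup>2)"
    using sq_summable_ell2_nth[of a] by (intro finite_sum_le_infsum) (auto simp: sq_summable_def)
  then have "(cmod (ell2_nth a n))\<^sup>2 \<le> (norm a)\<^sup>2" by (simp add: ell2_norm_sq)
  then show ?thesis by (rule power2_le_imp_le) simp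
qed

lemma norm_fst_ell2_le: "cmod (ell2_nth (fst z) n) \<le> norm (z :: ell2 \<times> herm_ell2)"
  using ell2_nth_le_norm[of "fst z" n] norm_fst_le[of "fst z" "snd z"] by simp

lemma from_ell2_scaleR:
  "from_ell2 s (\<epsilon> *\<^sub>R z) = (\<lambda>n. of_real \<epsilon> * fst (from_ell2 s z) n, \<lambda>n. of_real \<epsilon> * snd (from_ell2 s z) n)"
  by (simp add: from_ell2_def scaleR_ell2.rep_eq scaleR_herm_ell2.rep_eq scaleR_conv_of_real mult_ac)

lemma pmult_scale: "pmult (\<lambda>k. a * f k) (\<lambda>k. b * g k) n = a * b * pmult f g n"
proof -
  have "pmult (\<lambda>k. a * f k) (\<lambda>k. b * g k) n = (\<Sum>\<^sub>\<infinity>k. (a * b) * (f (n - k) * g k))"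
    unfolding pmult_def by (simp add: mult_ac)
  then show ?thesis by (simp add: pmult_def infsum_cmult_right')
qed

lemma duhamel_u_scale:
  "duhamel_u \<alpha> (\<lambda>t k. a * f t k) (\<lambda>t k. b * g t k) t n = a * b * duhamel_u \<alpha> f g t n"
  unfolding duhamel_u_def pmult_scale duhamel_cmult by simp

context sbo
begin

text \<open>At the data \<epsilon> z there are two expansions of the solution map: Taylor's, with
  error C |z|^2 \<epsilon>^2, and the Picard expansion, with explicit second-order term and error of
  order \<epsilon>^3. Comparing them bounds the second-order term. The size \<open>A\<close> of the
  data in the analytic norm enters only the cubic error, so the final bound sees only the norm of
  the phase space.\<close>

lemma C2_bilinear_bound:
  assumes wp: "sbo_wellposed \<alpha> \<beta> \<gamma> s T D \<Phi>" and C2: "sbo_C2_on s D (\<Phi> t)" and t: "t \<in> {-T..T}"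
  shows "\<exists>C. \<forall>z \<phi> \<psi> A n. from_ell2 s z = (\<phi>, \<psi>) \<longrightarrow>
    (\<forall>n. cmod (\<phi> n) \<le> A * wgt (T + 1) n) \<longrightarrow> (\<forall>n. cmod (\<psi> n) \<le> A * wgt (T + 1) n) \<longrightarrow> A \<ge> 0 \<longrightarrow>
    jb n powr s * cmod (duhamel_u \<alpha> (\<lambda>t n. U_mult t n * \<phi> n) (\<lambda>t n. V_mult \<gamma> t n * \<psi> n) t n) \<le> C * (norm z)\<^sup>2"
proof -
  define F where "F = to_ell2 s \<circ> \<Phi> t \<circ> from_ell2 s"
  define E where "E = to_ell2 s ` D"
  have D: "D \<subseteq> sbo_space s" and op: "open E" and D0: "(\<lambda>_. 0, \<lambda>_. 0) \<in> D"
    using wp by (auto simp: sbo_wellposed_def E_def)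
  have \<Phi>: "\<Phi> t w \<in> sbo_space s" if "w \<in> D" for w
    using wp that t unfolding sbo_wellposed_def cont_curve_def by blast
  have "from_ell2 s 0 = (\<lambda>_. 0, \<lambda>_. 0)"
    by (simp add: from_ell2_def zero_ell2.rep_eq zero_herm_ell2.rep_eq)
  then have E0: "0 \<in> E"
    using D0 to_from_ell2[of s 0] unfolding E_def by (metis imageI)
  have ED: "from_ell2 s y \<in> D" if "y \<in> E" for y
    using that D from_to_ell2 unfolding E_def by auto
  obtain L C \<delta> where L: "bounded_linear L" and \<delta>: "\<delta> > 0"
    and taylor: "\<And>y. norm y < \<delta> \<Longrightarrow> norm (F y - F 0 - L y) \<le> C * (norm y)\<^sup>2"
    by (rule C2_on_taylor[OF C2[unfolded sbo_C2_on_def, folded F_def E_def] op E0], rule that)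
  obtain r where r: "r > 0" "ball 0 r \<subseteq> E" using op E0 open_contains_ball by blast
  show ?thesis
  proof (intro exI[of _ C] allI impI)
    fix z \<phi> \<psi> A n
    assume z: "from_ell2 s z = (\<phi>, \<psi>)" and \<phi>: "\<forall>n. cmod (\<phi> n) \<le> A * wgt (T + 1) n"
      and \<psi>: "\<forall>n. cmod (\<psi> n) \<le> A * wgt (T + 1) n" and A: "A \<ge> 0"
    have \<psi>h: "hermitian \<psi>"
      using bij_betwE[OF bij_betw_from_ell2[of s]] z by (metis (mono_tags, lifting) UNIV_I mem_Collect_eq case_prodD sbo_space_def)
    define J where "J = complex_of_real (jb n powr s)"
    define q where "q = duhamel_u \<alpha> (\<lambda>t n. U_mult t n * \<phi> n) (\<lambda>t n. V_mult \<gamma> t n * \<psi> n) t n"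
    define a where "a = ell2_nth (fst (F 0)) n"
    define b where "b = ell2_nth (fst (L z)) n"
    \<comment> \<open>The three entries keep \<epsilon> z within reach of the Taylor estimate,
      inside the open set of admissible data, and small enough for the Picard iteration. Adding 1
      keeps the denominators positive.\<close>
    define \<epsilon>0 where "\<epsilon>0 = Min {\<delta> / (norm z + 1), r / (norm z + 1), 1 / (16 * K * A + 1)}"
    have pos: "norm z + 1 > 0" "16 * K * A + 1 > 0"
      using K_nonneg A by (auto intro: add_nonneg_pos)
    have \<epsilon>0: "\<epsilon>0 > 0" using \<delta> r(1) pos by (simp add: \<epsilon>0_def)
    have "cmod (J * q) \<le> C * (norm z)\<^sup>2"
    proof (rule second_coeff_le[OF \<epsilon>0])
      fix \<epsilon> :: real assume \<epsilon>: "0 < \<epsilon>" "\<epsilon> < \<epsilon>0"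
      have "\<epsilon> * (norm z + 1) < \<delta>" "\<epsilon> * (norm z + 1) < r" "\<epsilon> * (16 * K * A + 1) < 1"
        using \<epsilon>(2) pos unfolding \<epsilon>0_def by (simp_all add: pos_less_divide_eq)
      then have small: "norm (\<epsilon> *\<^sub>R z) < \<delta>" "norm (\<epsilon> *\<^sub>R z) < r" "16 * K * (\<epsilon> * A) \<le> 1"
        using \<epsilon>(1) by (auto simp: algebra_simps)
      have zE: "from_ell2 s (\<epsilon> *\<^sub>R z) \<in> D" using subsetD[OF r(2), of "\<epsilon> *\<^sub>R z"] small(2) by (intro ED) simp
      define w where "w = \<Phi> t (\<lambda>n. of_real \<epsilon> * \<phi> n, \<lambda>n. of_real \<epsilon> * \<psi> n)"
      have sc: "from_ell2 s (\<epsilon> *\<^sub>R z) = (\<lambda>n. of_real \<epsilon> * \<phi> n, \<lambda>n. of_real \<epsilon> * \<psi> n)"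
        unfolding from_ell2_scaleR z by simp
      have "cmod (fst w n - U_mult t n * (of_real \<epsilon> * \<phi> n)
        - duhamel_u \<alpha> (\<lambda>t n. U_mult t n * (of_real \<epsilon> * \<phi> n)) (\<lambda>t n. V_mult \<gamma> t n * (of_real \<epsilon> * \<psi> n)) t n)
        \<le> 12 * K\<^sup>2 * (\<epsilon> * A) ^ 3"
        unfolding w_def
      proof (rule wellposed_expansion[OF wp])
        show "cmod (of_real \<epsilon> * \<phi> n) \<le> \<epsilon> * A * wgt (T + 1) n" for n
          using \<phi>[rule_format, of n] \<epsilon>(1) by (simp add: norm_mult)
        show "cmod (of_real \<epsilon> * \<psi> n) \<le> \<epsilon> * A * wgt (T + 1) n" for n
          using \<psi>[rule_format, of n] \<epsilon>(1) by (simp add: norm_mult)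
        show "hermitian (\<lambda>n. of_real \<epsilon> * \<psi> n)" using \<psi>h by (simp add: hermitian_def)
      qed (use zE sc A \<epsilon>(1) small(3) t in auto)
      moreover have "duhamel_u \<alpha> (\<lambda>t n. U_mult t n * (of_real \<epsilon> * \<phi> n)) (\<lambda>t n. V_mult \<gamma> t n * (of_real \<epsilon> * \<psi> n)) t n
          = of_real (\<epsilon>\<^sup>2) * q"
        using duhamel_u_scale[of \<alpha> "of_real \<epsilon>" "\<lambda>t n. U_mult t n * \<phi> n" "of_real \<epsilon>" "\<lambda>t n. V_mult \<gamma> t n * \<psi> n" t n]
        by (simp add: q_def power2_eq_square mult_ac)
      ultimately have "cmod (fst w n - of_real \<epsilon> * (U_mult t n * \<phi> n) - of_real (\<epsilon>\<^sup>2) * q) \<le> 12 * K\<^sup>2 * (\<epsilon> * A) ^ 3"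
        by (simp add: mult_ac)
      then have 1: "cmod (J * (fst w n - of_real \<epsilon> * (U_mult t n * \<phi> n) - of_real (\<epsilon>\<^sup>2) * q))
          \<le> cmod J * (12 * K\<^sup>2 * (\<epsilon> * A) ^ 3)"
        unfolding norm_mult by (rule mult_left_mono) simp
      have "fst (F (\<epsilon> *\<^sub>R z)) = fst (to_ell2 s w)"
        by (simp add: F_def sc w_def)
      then have "J * fst w n = ell2_nth (fst (F (\<epsilon> *\<^sub>R z))) n"
        using ell2_nth_to_ell2(1)[OF \<Phi>[OF zE], of n] by (simp add: J_def w_def sc)
      moreover have "ell2_nth (fst (F (\<epsilon> *\<^sub>R z) - F 0 - L (\<epsilon> *\<^sub>R z))) n
          = ell2_nth (fst (F (\<epsilon> *\<^sub>R z))) n - a - of_real \<epsilon> * b"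
        by (simp add: ell2_nth_diff a_def b_def linear_simps(5)[OF L] scaleR_ell2.rep_eq scaleR_conv_of_real)
      moreover have "cmod (ell2_nth (fst (F (\<epsilon> *\<^sub>R z) - F 0 - L (\<epsilon> *\<^sub>R z))) n) \<le> C * (norm (\<epsilon> *\<^sub>R z))\<^sup>2"
        by (rule order.trans[OF norm_fst_ell2_le taylor[OF small(1)]])
      ultimately have 2: "cmod (J * fst w n - a - of_real \<epsilon> * b) \<le> C * (norm z)\<^sup>2 * \<epsilon>\<^sup>2"
        by (simp add: power_mult_distrib mult_ac)
      \<comment> \<open>Eliminating the unknown solution \<open>w\<close> between the two expansions
        leaves a polynomial in \<epsilon> of the form treated by
        \<open>second_coeff_le\<close>.\<close>
      have "- a + of_real \<epsilon> * (J * (U_mult t n * \<phi> n) - b) + of_real (\<epsilon>\<^sup>2) * (J * q)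
        = (J * fst w n - a - of_real \<epsilon> * b) - J * (fst w n - of_real \<epsilon> * (U_mult t n * \<phi> n) - of_real (\<epsilon>\<^sup>2) * q)"
        by (simp add: algebra_simps)
      also have "cmod \<dots> \<le> C * (norm z)\<^sup>2 * \<epsilon>\<^sup>2 + cmod J * (12 * K\<^sup>2 * (\<epsilon> * A) ^ 3)"
        by (rule order.trans[OF norm_triangle_ineq4 add_mono[OF 2 1]])
      also have "\<dots> = C * (norm z)\<^sup>2 * \<epsilon>\<^sup>2 + (cmod J * 12 * K\<^sup>2 * A ^ 3) * \<epsilon> ^ 3"
        by (simp add: power_mult_distrib mult_ac)
      finally show "cmod (- a + of_real \<epsilon> * (J * (U_mult t n * \<phi> n) - b) + of_real (\<epsilon>\<^sup>2) * (J * q))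
        \<le> C * (norm z)\<^sup>2 * \<epsilon>\<^sup>2 + (cmod J * 12 * K\<^sup>2 * A ^ 3) * \<epsilon> ^ 3" .
    qed
    then show "jb n powr s * cmod (duhamel_u \<alpha> (\<lambda>t n. U_mult t n * \<phi> n) (\<lambda>t n. V_mult \<gamma> t n * \<psi> n) t n) \<le> C * (norm z)\<^sup>2"
      by (simp add: J_def q_def norm_mult)
  qed
qed

end


section \<open>Resonant interactions\<close>

lemma U_mult_cis: "U_mult t n = cis (- (t * (of_int n)\<^sup>2))"
  unfolding U_mult_def deriv_mult_def cis_conv_exp by (simp add: power_mult_distrib mult.assoc)

lemma V_mult_cis: "V_mult \<gamma> t n = cis (- (\<gamma> * t * of_int (n * \<bar>n\<bar>)))"
proof -
  define N where "N = real_of_int (n * \<bar>n\<bar>)"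
  have "N = of_int (sgn n) * (of_int n)\<^sup>2"
    unfolding N_def by (cases n "0::int" rule: linorder_cases) (simp_all add: power2_eq_square)
  then have "complex_of_real N = of_int (sgn n) * (of_int n)\<^sup>2"
    by simp
  then show ?thesis
    unfolding V_mult_def deriv_mult_def hilbert_mult_def cis_conv_exp N_def[symmetric]
    by (simp add: power_mult_distrib mult_ac)
qed

text \<open>The phase stays in [-1, 1], hence within [-pi/3, pi/3], where the cosine is at least
  1/2; so there is no cancellation in the real part.\<close>

lemma norm_integral_cis_ge:
  assumes "\<bar>c\<bar> \<le> 1"
  shows "cmod (integral {0..1} (\<lambda>x. cis (c * x))) \<ge> 1/2"
proof -
  have int: "(\<lambda>x. cis (c * x)) integrable_on {0..1}"
    unfolding cis_conv_exp by (intro integrable_continuous_interval continuous_intros)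
  have "(1/2 :: real) = integral {0..1} (\<lambda>x::real. 1/2)" by simp
  also have "\<dots> \<le> integral {0..1} (\<lambda>x. cos (c * x))"
  proof (rule integral_le)
    show "(\<lambda>x. cos (c * x)) integrable_on {0..1}"
      by (intro integrable_continuous_interval continuous_intros)
    show "(\<lambda>x::real. 1/2 :: real) integrable_on {0..1}" by (rule integrable_const_ivl)
    fix x :: real assume "x \<in> {0..1}"
    then have "\<bar>c * x\<bar> \<le> 1 * 1" unfolding abs_mult using assms by (intro mult_mono) auto
    then have "cos (pi / 3) \<le> cos \<bar>c * x\<bar>" using pi_gt3 by (intro cos_monotone_0_pi_le) auto
    then show "1 / 2 \<le> cos (c * x)" by (simp add: cos_60)
  qed
  also have "\<dots> = Re (integral {0..1} (\<lambda>x. cis (c * x)))"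
    using integral_linear[OF int bounded_linear_Re] by (simp add: o_def)
  also have "\<dots> \<le> cmod (integral {0..1} (\<lambda>x. cis (c * x)))" by (rule complex_Re_le_cmod)
  finally show ?thesis .
qed

text \<open>The second datum carries both modes \<open>n2\<close> and \<open>- n2\<close> because it
  must be real. The bounds 2 on the resonance function and 1/2 on |t| keep the phase of the time
  integral within [-1, 1].\<close>

lemma duhamel_u_single_modes:
  assumes n2: "n2 \<noteq> 0" and t: "\<bar>t\<bar> \<le> 1/2"
    and res: "\<bar>(of_int (n1 + n2))\<^sup>2 - (of_int n1)\<^sup>2 - \<gamma> * of_int (n2 * \<bar>n2\<bar>)\<bar> \<le> (2 :: real)"
    and ab: "a \<ge> 0" "b \<ge> 0"
  shows "cmod (duhamel_u \<alpha> (\<lambda>t k. U_mult t k * (if k = n1 then of_real a else 0))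
      (\<lambda>t k. V_mult \<gamma> t k * (if k = n2 \<or> k = - n2 then of_real b else 0)) t (n1 + n2))
    \<ge> \<bar>\<alpha>\<bar> * \<bar>t\<bar> * a * b / 2"
proof -
  define \<theta> where "\<theta> = (of_int (n1 + n2))\<^sup>2 - (of_int n1)\<^sup>2 - \<gamma> * of_int (n2 * \<bar>n2\<bar>)"
  define n where "n = n1 + n2"
  define P where "P r = pmult (\<lambda>k. U_mult r k * (if k = n1 then of_real a else 0))
    (\<lambda>k. V_mult \<gamma> r k * (if k = n2 \<or> k = - n2 then of_real b else 0))" for r
  have P: "P r n = U_mult r n1 * V_mult \<gamma> r n2 * of_real (a * b)" for r
  proof -
    \<comment> \<open>The output frequency n1 + n2 selects k = n2; the mirror mode would require n1
      + 2 n2 = n1, impossible as \<open>n2\<close> is nonzero.\<close>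
    have "P r n = (\<Sum>\<^sub>\<infinity>k\<in>{n2}. (U_mult r (n - k) * (if n - k = n1 then of_real a else 0)) *
        (V_mult \<gamma> r k * (if k = n2 \<or> k = - n2 then of_real b else 0)))"
      unfolding P_def pmult_def by (rule infsum_cong_neutral) (auto simp: n_def)
    then show ?thesis by (simp add: n_def)
  qed
  \<comment> \<open>The \<open>r\<close>-dependent parts of the three phases combine to the
    resonance function \<theta>.\<close>
  have phase: "U_mult (t - r) n * (U_mult r n1 * V_mult \<gamma> r n2 * of_real (a * b))
      = of_real (a * b) * U_mult t n * cis (\<theta> * r)" for r
    unfolding U_mult_cis V_mult_cis \<theta>_def n_def
    by (simp add: cis_mult algebra_simps)
  have "duhamel U_mult P t n = integral {0..1} (\<lambda>x. of_real t * (U_mult (t - t * x) n * P (t * x) n))"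
  proof (rule duhamel_scaled[OF propagator_U])
    show "continuous_on {-\<bar>t\<bar>..\<bar>t\<bar>} (\<lambda>r. P r n)"
      unfolding P by (intro continuous_intros propagator_cont propagator_U propagator_V)
  qed auto
  also have "\<dots> = integral {0..1} (\<lambda>x. (of_real (t * (a * b)) * U_mult t n) * cis (\<theta> * t * x))"
    unfolding P phase by (simp add: mult_ac)
  also have "\<dots> = of_real (t * (a * b)) * U_mult t n * integral {0..1} (\<lambda>x. cis (\<theta> * t * x))"
    by (rule integral_mult_right)
  finally have duhamel: "duhamel U_mult P t n = \<dots>" .
  have "\<bar>\<theta> * t\<bar> \<le> 2 * (1/2)"
    unfolding abs_mult using res t by (intro mult_mono) (auto simp: \<theta>_def)
  then have "cmod (integral {0..1} (\<lambda>x. cis (\<theta> * t * x))) \<ge> 1/2"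
    by (intro norm_integral_cis_ge) simp
  then have "\<bar>\<alpha>\<bar> * \<bar>t\<bar> * a * b * (1/2)
      \<le> \<bar>\<alpha>\<bar> * \<bar>t\<bar> * a * b * cmod (integral {0..1} (\<lambda>x. cis (\<theta> * t * x)))"
    using ab by (intro mult_left_mono) auto
  also have "\<dots> = cmod (- \<i> * of_real \<alpha> * duhamel U_mult P t n)"
    unfolding duhamel using ab by (simp add: norm_mult abs_mult U_mult_cis)
  finally show ?thesis
    unfolding duhamel_u_def P_def[symmetric] n_def[symmetric] by simp
qed

lemma sobolev_norm_finite:
  assumes "finite S" "\<And>n. n \<notin> S \<Longrightarrow> f n = 0"
  shows "(sobolev_norm s f)\<^sup>2 = (\<Sum>n\<in>S. jb n powr (2 * s) * (cmod (f n))\<^sup>2)" "f \<in> sobolev s"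
proof -
  have "(\<Sum>\<^sub>\<infinity>n. jb n powr (2 * s) * (cmod (f n))\<^sup>2) = (\<Sum>\<^sub>\<infinity>n\<in>S. jb n powr (2 * s) * (cmod (f n))\<^sup>2)"
    by (rule infsum_cong_neutral) (use assms(2) in auto)
  then show "(sobolev_norm s f)\<^sup>2 = (\<Sum>n\<in>S. jb n powr (2 * s) * (cmod (f n))\<^sup>2)"
    using assms(1) by (simp add: sobolev_norm_def sum_nonneg)
  show "f \<in> sobolev s"
    unfolding sobolev_def mem_Collect_eq
    by (rule finite_nonzero_values_imp_summable_on)
       (rule finite_subset[OF _ assms(1)], use assms(2) in force)
qed

lemma jb_normalised: "jb n powr (2 * s) * (cmod (of_real (jb n powr (- s))))\<^sup>2 = 1"
  unfolding jb_weight_sq[symmetric] using jb_cancel(1)[of n s 1] by simp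

context sbo
begin

text \<open>The bilinear bound is tested on single modes normalised in the phase space, where the
  pair has squared norm 1 + 2 = 3. With the factor 1/2 from \<open>duhamel_u_single_modes\<close>
  this gives the 6 in the constant.\<close>

lemma resonant_estimate:
  assumes wp: "sbo_wellposed \<alpha> \<beta> \<gamma> s T D \<Phi>" and C2: "sbo_C2_on s D (\<Phi> t)"
    and t: "0 < \<bar>t\<bar>" "\<bar>t\<bar> \<le> 1/2" "\<bar>t\<bar> \<le> T" and \<alpha>: "\<alpha> \<noteq> 0"
  shows "\<exists>C. \<forall>n1 n2. n2 \<noteq> 0 \<longrightarrow>
      \<bar>(of_int (n1 + n2))\<^sup>2 - (of_int n1)\<^sup>2 - \<gamma> * of_int (n2 * \<bar>n2\<bar>)\<bar> \<le> 2 \<longrightarrow>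
      jb (n1 + n2) powr s \<le> C * (jb n1 powr s * jb n2 powr (s - 1/2))"
proof -
  have "t \<in> {-T..T}" using t by auto
  from C2_bilinear_bound[OF wp C2 this] obtain C where C: "\<forall>z \<phi> \<psi> A n. from_ell2 s z = (\<phi>, \<psi>) \<longrightarrow>
    (\<forall>n. cmod (\<phi> n) \<le> A * wgt (T + 1) n) \<longrightarrow> (\<forall>n. cmod (\<psi> n) \<le> A * wgt (T + 1) n) \<longrightarrow> A \<ge> 0 \<longrightarrow>
    jb n powr s * cmod (duhamel_u \<alpha> (\<lambda>t n. U_mult t n * \<phi> n) (\<lambda>t n. V_mult \<gamma> t n * \<psi> n) t n) \<le> C * (norm z)\<^sup>2" ..
  show ?thesis
  proof (intro exI[of _ "6 * C / (\<bar>\<alpha>\<bar> * \<bar>t\<bar>)"] allI impI)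
    fix n1 n2 :: int
    assume n2: "n2 \<noteq> 0"
      and res: "\<bar>(of_int (n1 + n2))\<^sup>2 - (of_int n1)\<^sup>2 - \<gamma> * of_int (n2 * \<bar>n2\<bar>)\<bar> \<le> 2"
    define a where "a = jb n1 powr (- s)"
    define b where "b = jb n2 powr (- (s - 1/2))"
    define \<phi> where "\<phi> = (\<lambda>k. if k = n1 then complex_of_real a else 0)"
    define \<psi> where "\<psi> = (\<lambda>k. if k = n2 \<or> k = - n2 then complex_of_real b else 0)"
    have ab: "a > 0" "b > 0" using jb_pos[of n1] jb_pos[of n2] by (simp_all add: a_def b_def)
    have \<phi>1: "(sobolev_norm s \<phi>)\<^sup>2 = 1"
      using sobolev_norm_finite(1)[of "{n1}" \<phi> s] jb_normalised[of n1 s] by (simp add: \<phi>_def a_def)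
    have \<psi>2: "(sobolev_norm (s - 1/2) \<psi>)\<^sup>2 = 2"
      using sobolev_norm_finite(1)[of "{n2, - n2}" \<psi> "s - 1/2"] jb_normalised[of n2 "s - 1/2"] n2
      by (simp add: \<psi>_def b_def jb_minus)
    have "(\<phi>, \<psi>) \<in> sbo_space s"
      using sobolev_norm_finite(2)[of "{n1}" \<phi> s] sobolev_norm_finite(2)[of "{n2, - n2}" \<psi> "s - 1/2"]
      by (auto simp: sbo_space_def \<phi>_def \<psi>_def hermitian_def)
    then have z: "from_ell2 s (to_ell2 s (\<phi>, \<psi>)) = (\<phi>, \<psi>)" by (rule from_to_ell2)
    have norm: "(norm (to_ell2 s (\<phi>, \<psi>)))\<^sup>2 = 3"
      unfolding norm_from_ell2[of _ s] z fst_conv snd_conv \<phi>1 \<psi>2 by simp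
    \<comment> \<open>Any \<open>A\<close> that dominates the two modes will do: it depends badly on
      the frequencies, but \<open>C\<close> does not depend on it.\<close>
    define A where "A = a / wgt (T + 1) n1 + b / wgt (T + 1) n2"
    have A: "A \<ge> 0" "a \<le> A * wgt (T + 1) n1" "b \<le> A * wgt (T + 1) n2"
      using ab wgt_pos[of "T + 1" n1] wgt_pos[of "T + 1" n2] by (simp_all add: A_def field_simps)
    have "jb (n1 + n2) powr s * (\<bar>\<alpha>\<bar> * \<bar>t\<bar> * a * b / 2)
      \<le> jb (n1 + n2) powr s * cmod (duhamel_u \<alpha> (\<lambda>t n. U_mult t n * \<phi> n) (\<lambda>t n. V_mult \<gamma> t n * \<psi> n) t (n1 + n2))"
      unfolding \<phi>_def \<psi>_def using ab by (intro mult_left_mono duhamel_u_single_modes n2 res t) auto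
    also have "\<dots> \<le> C * 3"
      using C[rule_format, OF z, of A "n1 + n2"] A ab unfolding norm by (auto simp: \<phi>_def \<psi>_def)
    finally have "jb (n1 + n2) powr s * (a * b) \<le> 6 * C / (\<bar>\<alpha>\<bar> * \<bar>t\<bar>)"
      using \<alpha> t(1) by (simp add: field_simps)
    then have "jb (n1 + n2) powr s * (a * b) / (a * b) \<le> 6 * C / (\<bar>\<alpha>\<bar> * \<bar>t\<bar>) / (a * b)"
      using ab by (intro divide_right_mono) auto
    moreover have "1 / (a * b) = jb n1 powr s * jb n2 powr (s - 1/2)"
      unfolding a_def b_def powr_minus by (simp only: divide_inverse inverse_mult_distrib inverse_inverse_eq mult_1_left)
    ultimately show "jb (n1 + n2) powr s \<le> 6 * C / (\<bar>\<alpha>\<bar> * \<bar>t\<bar>) * (jb n1 powr s * jb n2 powr (s - 1/2))"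
      using ab by (metis divide_inverse inverse_eq_divide less_numeral_extra(3) mult_pos_pos nonzero_mult_div_cancel_right)
  qed
qed

end

section \<open>Diophantine approximation and comparable frequencies\<close>

lemma infinitely_many_approximations:
  fixes \<theta> :: real
  obtains k h :: int where "k > M" "k > 0" "\<bar>of_int k * \<theta> - of_int h\<bar> \<le> 1 / of_int k"
proof (cases "\<exists>q::int. q > 0 \<and> of_int q * \<theta> \<in> \<int>")
  case True
  then obtain q h :: int where q: "q > 0" "of_int q * \<theta> = of_int h" by (auto elim: Ints_cases)
  \<comment> \<open>If some multiple of \<theta> is an integer, large multiples of that one have
    error 0.\<close>
  define m where "m = \<bar>M\<bar> + 1"
  have "m * 1 \<le> m * q" using q(1) by (intro mult_left_mono) (auto simp: m_def)
  then have "m \<le> m * q" by simp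
  moreover have "M < m" "0 < m" by (auto simp: m_def)
  ultimately have "m * q > M" "m * q > 0" by (meson less_le_trans)+
  moreover have "of_int (m * q) * \<theta> - of_int (m * h) = (0::real)"
    using q(2) by (simp add: mult.assoc)
  then have "\<bar>of_int (m * q) * \<theta> - of_int (m * h)\<bar> \<le> 1 / of_int (m * q)"
    using \<open>m * q > 0\<close> by (simp only: abs_zero zero_le_divide_1_iff of_int_0_le_iff less_imp_le)
  ultimately show ?thesis by (rule that)
next
  case False
  define dst where "dst k = \<bar>of_int k * \<theta> - of_int (round (of_int k * \<theta>))\<bar>" for k :: int
  \<comment> \<open>No positive \<open>k\<close> up to \<open>M\<close> approximates better than
    \<delta>, so precision finer than \<delta> in Dirichlet's theorem forces a denominator beyond
    \<open>M\<close>. The entry 1 keeps the set nonempty when M < 1.\<close>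
  define \<delta> where "\<delta> = Min (insert 1 (dst ` {1..M}))"
  have "dst k > 0" if "k > 0" for k
    using False that unfolding dst_def by (metis Ints_of_int eq_iff_diff_eq_0 zero_less_abs_iff)
  then have "\<delta> > 0" unfolding \<delta>_def by (subst Min_gr_iff) auto
  then obtain N :: nat where N: "N > 0" "1 / real N < \<delta>"
    by (metis inverse_eq_divide reals_Archimedean zero_less_Suc)
  from Dirichlet_approx[OF N(1)] obtain h k where
    hk: "0 < k" "k \<le> int N" "\<bar>of_int k * \<theta> - of_int h\<bar> < 1 / real N" by metis
  have "k > M"
  proof (rule ccontr)
    assume "\<not> k > M"
    then have "\<delta> \<le> dst k" using hk(1) unfolding \<delta>_def by (intro Min_le) auto
    also have "\<dots> \<le> \<bar>of_int k * \<theta> - of_int h\<bar>"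
      unfolding dst_def using round_diff_minimal[of "of_int k * \<theta>" h] by simp
    finally show False using N(2) hk(3) by simp
  qed
  moreover have "1 / real N \<le> 1 / of_int k"
    using hk(1,2) by (intro divide_left_mono) auto
  ultimately show ?thesis using that[of k h] hk by force
qed

text \<open>The sum of the two constants covers both signs of the exponent: the upper comparison is
  used for r \<ge> 0, the lower one for r < 0.\<close>

lemma powr_le_of_comparable:
  fixes x y c1 c2 r :: real
  assumes "0 < c1" "0 < c2" "0 < y" "c1 * y \<le> x" "x \<le> c2 * y"
  shows "x powr r \<le> (c1 powr r + c2 powr r) * y powr r"
proof (cases "r \<ge> 0")
  case True
  have "0 < c1 * y" using assms by simp
  then have "x powr r \<le> (c2 * y) powr r" using assms True by (intro powr_mono2) linarith+
  also have "\<dots> \<le> (c1 powr r + c2 powr r) * y powr r" by (simp add: powr_mult distrib_right)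
  finally show ?thesis .
next
  case False
  have "0 < c1 * y" using assms by simp
  then have "x powr r \<le> (c1 * y) powr r" using assms False by (intro powr_mono2') linarith+
  also have "\<dots> \<le> (c1 powr r + c2 powr r) * y powr r" by (simp add: powr_mult distrib_right)
  finally show ?thesis .
qed

lemma jb_ge: "\<bar>of_int n\<bar> \<le> jb n"
  unfolding jb_def by (intro real_le_rsqrt) auto

text \<open>An integer within distance 1 of \<kappa> k has modulus at least |\<kappa>| k / 2 once
  |\<kappa>| k \<ge> 2, and \<open>jb k\<close> lies between k and 2 k.\<close>

lemma jb_comparable:
  assumes "k > 0" "\<bar>of_int m - \<kappa> * of_int k\<bar> \<le> 1" "\<bar>\<kappa>\<bar> * of_int k \<ge> 2"
  shows "\<bar>\<kappa>\<bar> / 4 * jb k \<le> jb m" "jb m \<le> (\<bar>\<kappa>\<bar> + 2) * jb k"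
proof -
  have \<kappa>k: "\<bar>\<kappa> * of_int k\<bar> = \<bar>\<kappa>\<bar> * of_int k" using assms(1) by (simp add: abs_mult)
  have k: "jb k \<le> 2 * of_int k" using jb_le[of k] assms(1) by simp
  have "\<bar>\<kappa>\<bar> / 4 * jb k \<le> \<bar>\<kappa>\<bar> / 4 * (2 * of_int k)" using k by (intro mult_left_mono) auto
  also have "\<dots> \<le> \<bar>of_int m\<bar>" using assms(2,3) \<kappa>k by linarith
  finally show "\<bar>\<kappa>\<bar> / 4 * jb k \<le> jb m" using jb_ge[of m] by linarith
  have "jb m \<le> \<bar>\<kappa>\<bar> * of_int k + 2" using jb_le[of m] assms(2) \<kappa>k by linarith
  also have "\<dots> \<le> \<bar>\<kappa>\<bar> * jb k + 2 * jb k"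
    using jb_ge[of k] jb_ge_1[of k] assms(1) by (intro add_mono mult_left_mono) auto
  finally show "jb m \<le> (\<bar>\<kappa>\<bar> + 2) * jb k" by (simp add: distrib_right)
qed

lemma jb_powr_unbounded:
  assumes "r > 0" and "\<And>k::int. k > M \<Longrightarrow> k > 0 \<Longrightarrow> P k \<Longrightarrow> jb k powr r \<le> C"
    and "\<And>L::int. \<exists>k>L. k > 0 \<and> P k"
  shows False
proof -
  define L where "L = max M \<lceil>(\<bar>C\<bar> + 1) powr (1 / r)\<rceil>"
  obtain k where k: "k > L" "k > 0" "P k" using assms(3) by blast
  have "(\<bar>C\<bar> + 1) powr (1 / r) \<le> of_int k" using k(1) by (simp add: L_def) linarith
  also have "\<dots> \<le> jb k" using jb_ge[of k] by linarith
  finally have "((\<bar>C\<bar> + 1) powr (1 / r)) powr r \<le> jb k powr r"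
    using assms(1) by (intro powr_mono2) auto
  then have "\<bar>C\<bar> + 1 \<le> jb k powr r" using assms(1) by (simp add: powr_powr)
  also have "\<dots> \<le> C" using k by (intro assms(2)) (auto simp: L_def)
  finally show False by simp
qed

section \<open>The two cases of the theorem\<close>

theorem theorem1p1:
  fixes \<alpha> \<beta> \<gamma> s :: real
  assumes "\<alpha> \<noteq> 0" "\<beta> \<noteq> 0" "\<gamma> \<noteq> 0"
  shows "\<exists>t0>0. \<forall>t T D \<Phi>.
    0 < \<bar>t\<bar> \<and> \<bar>t\<bar> < t0 \<and> \<bar>t\<bar> \<le> T \<and> sbo_wellposed \<alpha> \<beta> \<gamma> s T D \<Phi> \<longrightarrow>
      (\<bar>\<gamma>\<bar> \<noteq> 1 \<longrightarrow> sbo_C2_on s D (\<Phi> t) \<longrightarrow> s \<ge> 1/2) \<and>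
      (\<bar>\<gamma>\<bar> = 1 \<longrightarrow> \<not> sbo_C2_on s D (\<Phi> t))"
\<comment> \<open>The time threshold 1/2 is the one that controls the phase in
  \<open>duhamel_u_single_modes\<close>.\<close>
proof (intro exI[of _ "1/2"] conjI allI impI)
  fix t T D \<Phi>
  assume asm: "0 < \<bar>t\<bar> \<and> \<bar>t\<bar> < 1/2 \<and> \<bar>t\<bar> \<le> T \<and> sbo_wellposed \<alpha> \<beta> \<gamma> s T D \<Phi>"
  then interpret sbo \<alpha> \<beta> \<gamma> T by unfold_locales auto
  {
    assume \<gamma>: "\<bar>\<gamma>\<bar> \<noteq> 1" and C2: "sbo_C2_on s D (\<Phi> t)"
    have "\<exists>C. \<forall>n1 n2. n2 \<noteq> 0 \<longrightarrow>
      \<bar>(of_int (n1 + n2))\<^sup>2 - (of_int n1)\<^sup>2 - \<gamma> * of_int (n2 * \<bar>n2\<bar>)\<bar> \<le> 2 \<longrightarrow>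
      jb (n1 + n2) powr s \<le> C * (jb n1 powr s * jb n2 powr (s - 1/2))"
      by (rule resonant_estimate[where \<Phi> = \<Phi> and t = t, OF _ C2]) (use asm assms in auto)
    then obtain C where C: "\<forall>n1 n2. n2 \<noteq> 0 \<longrightarrow>
      \<bar>(of_int (n1 + n2))\<^sup>2 - (of_int n1)\<^sup>2 - \<gamma> * of_int (n2 * \<bar>n2\<bar>)\<bar> \<le> 2 \<longrightarrow>
      jb (n1 + n2) powr s \<le> C * (jb n1 powr s * jb n2 powr (s - 1/2))" ..
    show "s \<ge> 1/2"
    proof (rule ccontr)
      assume "\<not> s \<ge> 1/2"
      \<comment> \<open>With n2 = k > 0 and n1 = h near \<kappa> k, the output frequency h + k is
        near \<kappa>' k, because \<kappa>' = \<kappa> + 1. Neither slope vanishes, as \<gamma> is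
        neither 1 nor -1, so all three frequencies have size comparable to k.\<close>
      define \<kappa> where "\<kappa> = (\<gamma> - 1) / 2"
      define \<kappa>' where "\<kappa>' = (\<gamma> + 1) / 2"
      have \<kappa>: "\<bar>\<kappa>\<bar> > 0" "\<bar>\<kappa>'\<bar> > 0" using \<gamma> by (auto simp: \<kappa>_def \<kappa>'_def)
      define c where "c = (\<bar>\<kappa>\<bar> / 4) powr s + (\<bar>\<kappa>\<bar> + 2) powr s"
      \<comment> \<open>The comparison of \<open>jb k\<close> with \<open>jb (h + k)\<close> is the
        inverse of that in \<open>jb_comparable\<close>, hence the reciprocal constants.\<close>
      define c' where "c' = (1 / (\<bar>\<kappa>'\<bar> + 2)) powr s + (4 / \<bar>\<kappa>'\<bar>) powr s"
      define P where "P k \<longleftrightarrow> (\<exists>h. \<bar>of_int k * \<kappa> - of_int h\<bar> \<le> 1 / of_int k)" for k :: int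
      show False
      proof (rule jb_powr_unbounded[of "1/2 - s" "\<lceil>2 / \<bar>\<kappa>\<bar>\<rceil> + \<lceil>2 / \<bar>\<kappa>'\<bar>\<rceil>" P "c' * (\<bar>C\<bar> * c)"])
        show "0 < 1/2 - s" using \<open>\<not> s \<ge> 1/2\<close> by simp
        show "\<exists>k>L. k > 0 \<and> P k" for L
          using infinitely_many_approximations[of L \<kappa>] unfolding P_def by metis
        fix k :: int
        assume k: "k > \<lceil>2 / \<bar>\<kappa>\<bar>\<rceil> + \<lceil>2 / \<bar>\<kappa>'\<bar>\<rceil>" "k > 0" "P k"
        obtain h :: int where h: "\<bar>of_int k * \<kappa> - of_int h\<bar> \<le> 1 / of_int k"
          using k(3) unfolding P_def by blast
        have "2 / \<bar>\<kappa>\<bar> \<ge> 0" "2 / \<bar>\<kappa>'\<bar> \<ge> 0" by auto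
        then have "2 / \<bar>\<kappa>\<bar> \<le> of_int k" "2 / \<bar>\<kappa>'\<bar> \<le> of_int k" using k(1) by linarith+
        then have large: "\<bar>\<kappa>\<bar> * of_int k \<ge> 2" "\<bar>\<kappa>'\<bar> * of_int k \<ge> 2"
          using \<kappa> by (simp_all add: field_simps)
        have "1 / of_int k \<le> (1::real)" using k(2) by simp
        then have near: "\<bar>of_int h - \<kappa> * of_int k\<bar> \<le> 1" using h by (simp add: abs_minus_commute mult.commute)
        have near': "\<bar>of_int (h + k) - \<kappa>' * of_int k\<bar> \<le> 1"
          using near by (simp add: \<kappa>_def \<kappa>'_def field_simps)
        \<comment> \<open>\<kappa> is the value of n1 / n2 at which the resonance function vanishes;
          an approximation error of 1 / k multiplied by 2 k leaves at most 2.\<close>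
        have "(of_int (h + k))\<^sup>2 - (of_int h)\<^sup>2 - \<gamma> * of_int (k * \<bar>k\<bar>)
            = - 2 * of_int k * (of_int k * \<kappa> - of_int h)"
          using k(2) by (simp add: \<kappa>_def power2_eq_square field_simps)
        also have "\<bar>\<dots>\<bar> = 2 * of_int k * \<bar>of_int k * \<kappa> - of_int h\<bar>"
          using k(2) by (simp add: abs_mult)
        also have "\<dots> \<le> 2 * of_int k * (1 / of_int k)"
          using h k(2) by (intro mult_left_mono) auto
        finally have res: "jb (h + k) powr s \<le> C * (jb h powr s * jb k powr (s - 1/2))"
          using k(2) by (intro C[rule_format]) auto
        note cmp = jb_comparable[OF k(2) near large(1)] and cmp' = jb_comparable[OF k(2) near' large(2)]
        \<comment> \<open>Replacing every frequency by k turns the resonant estimate into a bound on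
          k^(1/2 - s), which is unbounded for s < 1/2.\<close>
        have "jb k powr s \<le> c' * jb (h + k) powr s"
          unfolding c'_def using cmp' \<kappa>(2) jb_pos
          by (intro powr_le_of_comparable) (auto simp: field_simps)
        also have "\<dots> \<le> c' * (C * (jb h powr s * jb k powr (s - 1/2)))"
          by (intro mult_left_mono res) (simp add: c'_def)
        also have "\<dots> \<le> c' * (\<bar>C\<bar> * ((c * jb k powr s) * jb k powr (s - 1/2)))"
        proof -
          have "jb h powr s \<le> c * jb k powr s"
            unfolding c_def using cmp \<kappa>(1) jb_pos by (intro powr_le_of_comparable) auto
          then have "C * (jb h powr s * jb k powr (s - 1/2)) \<le> \<bar>C\<bar> * ((c * jb k powr s) * jb k powr (s - 1/2))"
            by (intro mult_mono) (auto simp: c_def)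
          then show ?thesis by (intro mult_left_mono) (simp_all add: c'_def)
        qed
        also have "\<dots> = jb k powr s * (c' * (\<bar>C\<bar> * c) * jb k powr (s - 1/2))" by (simp add: mult_ac)
        finally have "1 \<le> c' * (\<bar>C\<bar> * c) * jb k powr (s - 1/2)"
          using jb_pos[of k] by simp
        then have "1 * jb k powr (1/2 - s) \<le> c' * (\<bar>C\<bar> * c) * jb k powr (s - 1/2) * jb k powr (1/2 - s)"
          by (intro mult_right_mono) auto
        also have "\<dots> = c' * (\<bar>C\<bar> * c) * (jb k powr (s - 1/2) * jb k powr (1/2 - s))" by (simp only: mult.assoc)
        also have "jb k powr (s - 1/2) * jb k powr (1/2 - s) = 1"
          using jb_pos[of k] by (simp add: powr_add[symmetric])
        finally show "jb k powr (1/2 - s) \<le> c' * (\<bar>C\<bar> * c)" by simp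
      qed
    qed
  }
  {
    assume \<gamma>: "\<bar>\<gamma>\<bar> = 1"
    show "\<not> sbo_C2_on s D (\<Phi> t)"
    proof
      assume C2: "sbo_C2_on s D (\<Phi> t)"
      have "\<exists>C. \<forall>n1 n2. n2 \<noteq> 0 \<longrightarrow>
        \<bar>(of_int (n1 + n2))\<^sup>2 - (of_int n1)\<^sup>2 - \<gamma> * of_int (n2 * \<bar>n2\<bar>)\<bar> \<le> 2 \<longrightarrow>
        jb (n1 + n2) powr s \<le> C * (jb n1 powr s * jb n2 powr (s - 1/2))"
        by (rule resonant_estimate[where \<Phi> = \<Phi> and t = t, OF _ C2]) (use asm assms in auto)
      then obtain C where C: "\<forall>n1 n2. n2 \<noteq> 0 \<longrightarrow>
        \<bar>(of_int (n1 + n2))\<^sup>2 - (of_int n1)\<^sup>2 - \<gamma> * of_int (n2 * \<bar>n2\<bar>)\<bar> \<le> 2 \<longrightarrow>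
        jb (n1 + n2) powr s \<le> C * (jb n1 powr s * jb n2 powr (s - 1/2))" ..
      show False
      proof (rule jb_powr_unbounded[of "1/2" 0 "\<lambda>_. True" C])
        show "\<exists>k>L. k > 0 \<and> True" for L :: int by (rule exI[of _ "\<bar>L\<bar> + 1"]) auto
        fix k :: int assume k: "k > 0"
        \<comment> \<open>Choosing the sign of \<open>n2\<close> to be that of \<gamma> makes the
          resonance function vanish exactly at n1 = 0.\<close>
        obtain n2 where n2: "n2 \<noteq> 0" "\<gamma> * of_int (n2 * \<bar>n2\<bar>) = (of_int n2)\<^sup>2" "jb n2 = jb k"
        proof (cases "\<gamma> = 1")
          case True
          then show ?thesis using that[of k] k by (simp add: power2_eq_square)
        next
          case False
          then have "\<gamma> = - 1" using \<gamma> by auto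
          then show ?thesis using that[of "- k"] k by (simp add: power2_eq_square jb_minus)
        qed
        have "jb 0 = 1" by (simp add: jb_def)
        \<comment> \<open>The mode n1 = 0 contributes the weight 1, so the output and the mode of
          the second component have the same frequency size; s cancels and the half derivative
          remains, whatever s is.\<close>
        then have "jb k powr s \<le> C * jb k powr (s - 1/2)"
          using C[rule_format, of n2 0] n2 by simp
        then have "jb k powr s * jb k powr (1/2 - s) \<le> C * jb k powr (s - 1/2) * jb k powr (1/2 - s)"
          by (rule mult_right_mono) simp
        then show "jb k powr (1/2) \<le> C"
          using jb_pos[of k] by (simp add: mult.assoc powr_add[symmetric])
      qed simp
    qed
  }
qed simp

end
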